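(* Let $G$ be a finite group acting on a category $K$ without inverses so that Condition (C) is satisfied. Then for every $i$ $$\beta_i(\Delta(K/G))=\langle\gamma_i,1\rangle,$$ where $\gamma_i$ is the induced representation of $G$ on $H_i(\Delta(K))$.
   Context: For a small category $K$, $\mathcal M(K)$ is its set of morphisms; a morphism $m$ from $a$ to $b$ has $\partial^\bullet m=a$ (source) and $\partial_\bullet m=b$ (target). $K$ is a category without inverses if only identity morphisms have inverses. A group $G$ (viewed as a one-object category) acts on $K$ if there is a functor $\mathcal A_K:G\to\mathbf{Cat}$ ($\mathbf{Cat}$ = category of small categories) sending the unique object to $K$; thus each $g\in G$ acts as an automorphism of $K$. $Gx$ denotes the orbit of $x$. The quotient $K/G$ is the colimit of $\mathcal A_K$ in $\mathbf{Cat}$. $\Delta(K)$ is the nerve of $K$. Condition (C): for every $t\ge 2$, if $m_1,\dots,m_{t-1},m_a,m_b\in\mathcal M(K)$ satisfy $\partial^\bullet m_i=\partial_\bullet m_{i-1}$ for all $2\le i\le t-1$, $\partial^\bullet m_a=\partial^\bullet m_b=\partial_\bullet m_{t-1}$, and $Gm_a=Gm_b$, then there is $g\in G$ with $gm_a=m_b$ and $gm_i=m_i$ for $1\le i\le t-1$. Homology is taken with complex coefficients, $\beta_i$ denotes the $i$-th Betti number, and $\langle\gamma_i,1\rangle$ is the multiplicity of the trivial character in $\gamma_i$, i.e. the dimension of the space of $G$-invariants of $H_i(\Delta(K))$. *)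

theory Defs
  imports "Jordan_Normal_Form.VS_Connect" "HOL-Algebra.AbelCoset" "HOL-Algebra.Group_Action"
    "HOL-Library.Poly_Mapping"
begin

unbundle cardinal_syntax

section \<open>Small categories and functors\<close>

text \<open>\<open>cmp K g f\<close> is the composite ``first \<open>f\<close>, then \<open>g\<close>''; it is meaningful only if
  \<open>src K g = tgt K f\<close>.\<close>

record ('o, 'm) cat =
  Obj :: "'o set"
  Mor :: "'m set"
  src :: "'m \<Rightarrow> 'o"
  tgt :: "'m \<Rightarrow> 'o"
  ident :: "'o \<Rightarrow> 'm"
  cmp :: "'m \<Rightarrow> 'm \<Rightarrow> 'm"

locale category =
  fixes K :: "('o, 'm) cat"
  assumes src_closed: "f \<in> Mor K \<Longrightarrow> src K f \<in> Obj K"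
    and tgt_closed: "f \<in> Mor K \<Longrightarrow> tgt K f \<in> Obj K"
    and ident_closed: "a \<in> Obj K \<Longrightarrow> ident K a \<in> Mor K"
    and src_ident: "a \<in> Obj K \<Longrightarrow> src K (ident K a) = a"
    and tgt_ident: "a \<in> Obj K \<Longrightarrow> tgt K (ident K a) = a"
    and cmp_closed: "\<lbrakk>f \<in> Mor K; g \<in> Mor K; src K g = tgt K f\<rbrakk> \<Longrightarrow> cmp K g f \<in> Mor K"
    and src_cmp: "\<lbrakk>f \<in> Mor K; g \<in> Mor K; src K g = tgt K f\<rbrakk> \<Longrightarrow> src K (cmp K g f) = src K f"
    and tgt_cmp: "\<lbrakk>f \<in> Mor K; g \<in> Mor K; src K g = tgt K f\<rbrakk> \<Longrightarrow> tgt K (cmp K g f) = tgt K g"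
    and cmp_ident_right: "f \<in> Mor K \<Longrightarrow> cmp K f (ident K (src K f)) = f"
    and cmp_ident_left: "f \<in> Mor K \<Longrightarrow> cmp K (ident K (tgt K f)) f = f"
    and cmp_assoc: "\<lbrakk>f \<in> Mor K; g \<in> Mor K; h \<in> Mor K; src K g = tgt K f; src K h = tgt K g\<rbrakk>
      \<Longrightarrow> cmp K h (cmp K g f) = cmp K (cmp K h g) f"

definition without_inverses :: "('o, 'm) cat \<Rightarrow> bool" where
  "without_inverses K \<longleftrightarrow>
    (\<forall>f\<in>Mor K. \<forall>g\<in>Mor K. src K g = tgt K f \<and> tgt K g = src K f \<and>
        cmp K g f = ident K (src K f) \<and> cmp K f g = ident K (tgt K f)
      \<longrightarrow> f = ident K (src K f))"

text \<open>A functor is a pair of maps, on objects and on morphisms. Their values outside the category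
  are irrelevant, so two functors are considered equal if they agree on \<open>Obj\<close> and on \<open>Mor\<close>.\<close>

definition cat_functor ::
  "('o, 'm) cat \<Rightarrow> ('p, 'n) cat \<Rightarrow> ('o \<Rightarrow> 'p) \<Rightarrow> ('m \<Rightarrow> 'n) \<Rightarrow> bool" where
  "cat_functor K L F\<^sub>o F\<^sub>m \<longleftrightarrow>
    F\<^sub>o \<in> Obj K \<rightarrow> Obj L \<and> F\<^sub>m \<in> Mor K \<rightarrow> Mor L \<and>
    (\<forall>f\<in>Mor K. src L (F\<^sub>m f) = F\<^sub>o (src K f) \<and> tgt L (F\<^sub>m f) = F\<^sub>o (tgt K f)) \<and>
    (\<forall>a\<in>Obj K. F\<^sub>m (ident K a) = ident L (F\<^sub>o a)) \<and>
    (\<forall>f\<in>Mor K. \<forall>g\<in>Mor K. src K g = tgt K f \<longrightarrow> F\<^sub>m (cmp K g f) = cmp L (F\<^sub>m g) (F\<^sub>m f))"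

section \<open>Group actions on categories and their quotients\<close>

text \<open>A functor from the one-object category of the group \<open>G\<close> to the category of small categories
  with value \<open>K\<close>: every group element \<open>g\<close> yields an endofunctor \<open>(A\<^sub>o g, A\<^sub>m g)\<close> of \<open>K\<close>,
  compatibly with unit and multiplication.\<close>

locale cat_action = group G + category K
  for G :: "('g, 'x) monoid_scheme" and K :: "('o, 'm) cat" +
  fixes A\<^sub>o :: "'g \<Rightarrow> 'o \<Rightarrow> 'o" and A\<^sub>m :: "'g \<Rightarrow> 'm \<Rightarrow> 'm"
  assumes act_functor: "g \<in> carrier G \<Longrightarrow> cat_functor K K (A\<^sub>o g) (A\<^sub>m g)"
    and act_one_obj: "a \<in> Obj K \<Longrightarrow> A\<^sub>o \<one>\<^bsub>G\<^esub> a = a"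
    and act_one_mor: "f \<in> Mor K \<Longrightarrow> A\<^sub>m \<one>\<^bsub>G\<^esub> f = f"
    and act_mult_obj: "\<lbrakk>g \<in> carrier G; h \<in> carrier G; a \<in> Obj K\<rbrakk>
      \<Longrightarrow> A\<^sub>o (g \<otimes>\<^bsub>G\<^esub> h) a = A\<^sub>o g (A\<^sub>o h a)"
    and act_mult_mor: "\<lbrakk>g \<in> carrier G; h \<in> carrier G; f \<in> Mor K\<rbrakk>
      \<Longrightarrow> A\<^sub>m (g \<otimes>\<^bsub>G\<^esub> h) f = A\<^sub>m g (A\<^sub>m h f)"

definition condition_C :: "('g, 'x) monoid_scheme \<Rightarrow> ('o, 'm) cat \<Rightarrow> ('g \<Rightarrow> 'm \<Rightarrow> 'm) \<Rightarrow> bool" where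
  "condition_C G K A\<^sub>m \<longleftrightarrow>
    (\<forall>t::nat. t \<ge> 2 \<longrightarrow> (\<forall>m m\<^sub>a m\<^sub>b.
      (\<forall>i\<in>{1..t-1}. m i \<in> Mor K) \<and> m\<^sub>a \<in> Mor K \<and> m\<^sub>b \<in> Mor K \<and>
      (\<forall>i\<in>{2..t-1}. src K (m i) = tgt K (m (i-1))) \<and>
      src K m\<^sub>a = tgt K (m (t-1)) \<and> src K m\<^sub>b = tgt K (m (t-1)) \<and>
      orbit G A\<^sub>m m\<^sub>a = orbit G A\<^sub>m m\<^sub>b
      \<longrightarrow> (\<exists>g\<in>carrier G. A\<^sub>m g m\<^sub>a = m\<^sub>b \<and> (\<forall>i\<in>{1..t-1}. A\<^sub>m g (m i) = m i))))"

text \<open>A cocone from the diagram of an action to a category \<open>L\<close> is a functor from \<open>K\<close> to \<open>L\<close> that is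
  invariant under precomposition with the action.\<close>

definition action_cocone :: "('g, 'x) monoid_scheme \<Rightarrow> ('o, 'm) cat \<Rightarrow> ('g \<Rightarrow> 'o \<Rightarrow> 'o) \<Rightarrow> ('g \<Rightarrow> 'm \<Rightarrow> 'm)
    \<Rightarrow> ('p, 'n) cat \<Rightarrow> ('o \<Rightarrow> 'p) \<Rightarrow> ('m \<Rightarrow> 'n) \<Rightarrow> bool" where
  "action_cocone G K A\<^sub>o A\<^sub>m L F\<^sub>o F\<^sub>m \<longleftrightarrow>
    category L \<and> cat_functor K L F\<^sub>o F\<^sub>m \<and>
    (\<forall>g\<in>carrier G. (\<forall>a\<in>Obj K. F\<^sub>o (A\<^sub>o g a) = F\<^sub>o a) \<and> (\<forall>f\<in>Mor K. F\<^sub>m (A\<^sub>m g f) = F\<^sub>m f))"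

text \<open>\<open>Q\<close> with the projection \<open>(P\<^sub>o, P\<^sub>m)\<close> is the quotient of \<open>K\<close> by \<open>G\<close>: the colimit of the action
  in the category of small categories. HOL cannot quantify over all types inside a formula, so
  ``small'' refers to the universe given by the types \<open>'o\<close> of objects and \<open>'m\<close> of morphisms, which are
  arbitrary. Under condition (C) nothing is lost: every object and every morphism of the true
  colimit is then the class of one of \<open>K\<close>, hence the true colimit has an isomorphic copy in these
  types, and it is the unique one (up to isomorphism) with the property below.\<close>

definition is_quotient :: "('g, 'x) monoid_scheme \<Rightarrow> ('o, 'm) cat \<Rightarrow> ('g \<Rightarrow> 'o \<Rightarrow> 'o) \<Rightarrow> ('g \<Rightarrow> 'm \<Rightarrow> 'm)
    \<Rightarrow> ('o, 'm) cat \<Rightarrow> ('o \<Rightarrow> 'o) \<Rightarrow> ('m \<Rightarrow> 'm) \<Rightarrow> bool" where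
  "is_quotient G K A\<^sub>o A\<^sub>m Q P\<^sub>o P\<^sub>m \<longleftrightarrow>
    action_cocone G K A\<^sub>o A\<^sub>m Q P\<^sub>o P\<^sub>m \<and>
    (\<forall>(L :: ('o, 'm) cat) F\<^sub>o F\<^sub>m. action_cocone G K A\<^sub>o A\<^sub>m L F\<^sub>o F\<^sub>m \<longrightarrow>
      (\<exists>U\<^sub>o U\<^sub>m. cat_functor Q L U\<^sub>o U\<^sub>m \<and>
        (\<forall>a\<in>Obj K. U\<^sub>o (P\<^sub>o a) = F\<^sub>o a) \<and> (\<forall>f\<in>Mor K. U\<^sub>m (P\<^sub>m f) = F\<^sub>m f) \<and>
        (\<forall>V\<^sub>o V\<^sub>m. cat_functor Q L V\<^sub>o V\<^sub>m \<and>
            (\<forall>a\<in>Obj K. V\<^sub>o (P\<^sub>o a) = F\<^sub>o a) \<and> (\<forall>f\<in>Mor K. V\<^sub>m (P\<^sub>m f) = F\<^sub>m f)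
          \<longrightarrow> (\<forall>b\<in>Obj Q. V\<^sub>o b = U\<^sub>o b) \<and> (\<forall>h\<in>Mor Q. V\<^sub>m h = U\<^sub>m h))))"

section \<open>Simplicial sets and nerves\<close>

text \<open>\<open>face X n i\<close> and \<open>degen X n i\<close> (for \<open>i \<le> n\<close>) have the \<open>n\<close>-simplices as domain.\<close>

record 's sset =
  simplices :: "nat \<Rightarrow> 's set"
  face :: "nat \<Rightarrow> nat \<Rightarrow> 's \<Rightarrow> 's"
  degen :: "nat \<Rightarrow> nat \<Rightarrow> 's \<Rightarrow> 's"

fun is_path :: "('o, 'm) cat \<Rightarrow> 'o \<Rightarrow> 'm list \<Rightarrow> bool" where
  "is_path K a [] \<longleftrightarrow> a \<in> Obj K"
| "is_path K a (f # fs) \<longleftrightarrow> a \<in> Obj K \<and> f \<in> Mor K \<and> src K f = a \<and> is_path K (tgt K f) fs"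

text \<open>An \<open>n\<close>-simplex \<open>a\<^sub>0 \<rightarrow> a\<^sub>1 \<rightarrow> \<dots> \<rightarrow> a\<^sub>n\<close> of the nerve is the pair of its initial object \<open>a\<^sub>0\<close> and the
  list of its \<open>n\<close> morphisms; the object is redundant unless \<open>n = 0\<close>. The list position \<open>i\<close> holds the
  morphism \<open>a\<^sub>i \<rightarrow> a\<^sub>i\<^sub>+\<^sub>1\<close>.\<close>

definition nerve_simplices :: "('o, 'm) cat \<Rightarrow> nat \<Rightarrow> ('o \<times> 'm list) set" where
  "nerve_simplices K n = {(a, fs). length fs = n \<and> is_path K a fs}"

fun nerve_face :: "('o, 'm) cat \<Rightarrow> nat \<Rightarrow> nat \<Rightarrow> 'o \<times> 'm list \<Rightarrow> 'o \<times> 'm list" where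
  "nerve_face K n i (a, fs) =
    (if i = 0 then (tgt K (hd fs), tl fs)
     else if i = n then (a, butlast fs)
     else (a, take (i-1) fs @ cmp K (fs ! i) (fs ! (i-1)) # drop (i+1) fs))"

fun nerve_degen :: "('o, 'm) cat \<Rightarrow> nat \<Rightarrow> nat \<Rightarrow> 'o \<times> 'm list \<Rightarrow> 'o \<times> 'm list" where
  "nerve_degen K n i (a, fs) =
    (a, take i fs @ ident K (if i = 0 then a else tgt K (fs ! (i-1))) # drop i fs)"

definition nerve :: "('o, 'm) cat \<Rightarrow> ('o \<times> 'm list) sset" where
  "nerve K = \<lparr>simplices = nerve_simplices K, face = nerve_face K, degen = nerve_degen K\<rparr>"

definition nerve_map :: "('o \<Rightarrow> 'p) \<Rightarrow> ('m \<Rightarrow> 'n) \<Rightarrow> 'o \<times> 'm list \<Rightarrow> 'p \<times> 'n list" where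
  "nerve_map F\<^sub>o F\<^sub>m = map_prod F\<^sub>o (map F\<^sub>m)"

section \<open>Simplicial homology with complex coefficients\<close>

text \<open>Homology is that of the complex freely generated by all simplices, degenerate ones included;
  dividing out the (acyclic) subcomplex of the degenerate simplices would not change it.
  The fields \<open>mult\<close> and \<open>one\<close> of a module record are not used.\<close>

type_synonym 's chain = "'s \<Rightarrow>\<^sub>0 complex"

definition chain_module :: "'s sset \<Rightarrow> nat \<Rightarrow> (complex, 's chain) module" where
  "chain_module X n =
    \<lparr>carrier = {c. Poly_Mapping.keys c \<subseteq> simplices X n}, mult = undefined, one = undefined,
     zero = 0, add = (+), smult = (\<lambda>z. Poly_Mapping.map ((*) z))\<rparr>"

definition boundary :: "'s sset \<Rightarrow> nat \<Rightarrow> 's chain \<Rightarrow> 's chain" where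
  "boundary X n c =
    (if n = 0 then 0
     else \<Sum>s\<in>Poly_Mapping.keys c. \<Sum>i\<le>n.
       Poly_Mapping.single (face X n i s) ((-1) ^ i * Poly_Mapping.lookup c s))"

definition cycles :: "'s sset \<Rightarrow> nat \<Rightarrow> 's chain set" where
  "cycles X n = {c \<in> carrier (chain_module X n). boundary X n c = 0}"

definition boundaries :: "'s sset \<Rightarrow> nat \<Rightarrow> 's chain set" where
  "boundaries X n = boundary X (Suc n) ` carrier (chain_module X (Suc n))"

text \<open>The quotient of a module by a submodule \<open>N\<close>, with the cosets of \<open>N\<close> as elements.\<close>

definition quotient_module :: "('r, 'v, 'x) module_scheme \<Rightarrow> 'v set \<Rightarrow> ('r, 'v set) module" where
  "quotient_module M N =
    \<lparr>carrier = a_rcosets\<^bsub>M\<^esub> N, mult = undefined, one = undefined,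
     zero = N, add = set_add M, smult = (\<lambda>r C. N <+>\<^bsub>M\<^esub> (smult M r ` C))\<rparr>"

definition homology :: "'s sset \<Rightarrow> nat \<Rightarrow> (complex, 's chain set) module" where
  "homology X n = quotient_module ((chain_module X n)\<lparr>carrier := cycles X n\<rparr>) (boundaries X n)"

definition chain_map :: "('s \<Rightarrow> 't) \<Rightarrow> 's chain \<Rightarrow> 't chain" where
  "chain_map \<phi> c =
    (\<Sum>s\<in>Poly_Mapping.keys c. Poly_Mapping.single (\<phi> s) (Poly_Mapping.lookup c s))"

text \<open>The map induced on the \<open>n\<close>-th homology by a simplicial map \<open>\<phi>\<close> into \<open>Y\<close>; it sends the class
  of a cycle \<open>c\<close> to the class of \<open>chain_map \<phi> c\<close>.\<close>

definition homology_map :: "'t sset \<Rightarrow> nat \<Rightarrow> ('s \<Rightarrow> 't) \<Rightarrow> 's chain set \<Rightarrow> 't chain set" where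
  "homology_map Y n \<phi> C = boundaries Y n <+>\<^bsub>chain_module Y n\<^esub> (chain_map \<phi> ` C)"

section \<open>Dimensions, Betti numbers and multiplicities\<close>

text \<open>The category \<open>K\<close> may be infinite, so dimensions are cardinal numbers (up to the equality of
  cardinals \<open>=o\<close>).\<close>

definition vs_dim :: "(complex, 'v, 'x) module_scheme \<Rightarrow> 'v rel" where
  "vs_dim V = |SOME B. vectorspace.basis class_ring V B|"

definition betti :: "'s sset \<Rightarrow> nat \<Rightarrow> 's chain set rel" where
  "betti X i = vs_dim (homology X i)"

definition induced_rep :: "('o, 'm) cat \<Rightarrow> ('g \<Rightarrow> 'o \<Rightarrow> 'o) \<Rightarrow> ('g \<Rightarrow> 'm \<Rightarrow> 'm) \<Rightarrow> nat
    \<Rightarrow> 'g \<Rightarrow> ('o \<times> 'm list) chain set \<Rightarrow> ('o \<times> 'm list) chain set" where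
  "induced_rep K A\<^sub>o A\<^sub>m i g = homology_map (nerve K) i (nerve_map (A\<^sub>o g) (A\<^sub>m g))"

text \<open>Multiplicity of the trivial character in a complex representation \<open>\<rho>\<close> of \<open>G\<close> on \<open>V\<close>.\<close>

definition trivial_multiplicity ::
  "('g, 'y) monoid_scheme \<Rightarrow> (complex, 'v, 'x) module_scheme \<Rightarrow> ('g \<Rightarrow> 'v \<Rightarrow> 'v) \<Rightarrow> 'v rel" where
  "trivial_multiplicity G V \<rho> = vs_dim (V\<lparr>carrier := {v \<in> carrier V. \<forall>g\<in>carrier G. \<rho> g v = v}\<rparr>)"

end

theory Submission
  imports Defs
begin

text \<open>Under condition (C) the quotient category has the orbits of objects and morphisms as its objects
  and morphisms. Condition (C) for two morphisms makes the composition of orbits well defined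
  (\<open>rep_cmp\<close>), so the orbits form a category. Its comparison with the colimit shows that the
  projection from \<open>K\<close> to \<open>K/G\<close> is onto and identifies exactly the elements of one orbit
  (\<open>ex_comparison\<close>). For longer paths, condition (C) shows that two paths of \<open>K\<close> with the same image in
  \<open>K/G\<close> are translates of one another by a single group element (\<open>path_orbit\<close>), and paths of \<open>K/G\<close> lift
  to \<open>K\<close> (\<open>lift_path\<close>). Hence the nerve of \<open>K/G\<close> is the quotient of the nerve of \<open>K\<close> by \<open>G\<close>.

  It remains to see that the homology of a simplicial set \<open>Y = X/G\<close> is the space of invariants of the
  homology of \<open>X\<close>. Let \<open>p\<close> be the projection on chains and let \<open>N\<close> be the sum of all elements of \<open>G\<close>.
  Then \<open>p\<close> is onto, \<open>p\<close> composed with \<open>N\<close> is the multiple of \<open>p\<close> by the order of \<open>G\<close>, and \<open>N\<close> vanishes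
  on the kernel of \<open>p\<close>. Over the complex numbers the order is invertible. So every cycle of \<open>Y\<close> is the
  projection of an invariant cycle of \<open>X\<close> (\<open>ex_invariant_cycle\<close>). If conversely the projection of a
  cycle \<open>c\<close> with invariant class bounds, then \<open>N c\<close>, which is homologous to a non-zero multiple of \<open>c\<close>,
  bounds as well (\<open>invariant_cycle_boundary\<close>).

  Dimensions are compared through embeddings of both spaces onto one subspace of a space of chains
  (\<open>vs_dim_eqI\<close>), where any two bases of a subspace are equipotent, also in infinite
  dimension.\<close>

section \<open>Linear algebra in spaces of chains\<close>

text \<open>Scalar multiplication of chains, as in \<open>chain_module\<close>.\<close>

abbreviation scl :: "complex \<Rightarrow> 's chain \<Rightarrow> 's chain" where
  "scl z \<equiv> Poly_Mapping.map ((*) z)"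

lemma lookup_scl [simp]: "Poly_Mapping.lookup (scl z c) s = z * Poly_Mapping.lookup c s"
  by (cases "Poly_Mapping.lookup c s = 0") (simp_all add: Poly_Mapping.map.rep_eq)

interpretation chains: vector_space "scl :: complex \<Rightarrow> 's chain \<Rightarrow> 's chain"
  by unfold_locales (auto intro!: poly_mapping_eqI simp: lookup_add algebra_simps)

interpretation chain_pair: vector_space_pair
  "scl :: complex \<Rightarrow> 's chain \<Rightarrow> 's chain" "scl :: complex \<Rightarrow> 't chain \<Rightarrow> 't chain" ..

abbreviation chain_linear :: "('s chain \<Rightarrow> 't chain) \<Rightarrow> bool" where
  "chain_linear \<equiv> Vector_Spaces.linear scl scl"

lemma chain_linearI:
  assumes "\<And>c d. f (c + d) = f c + f d" and "\<And>z c. f (scl z c) = scl z (f c)"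
  shows "chain_linear f"
  using assms by (simp add: Vector_Spaces.linear_iff chains.vector_space_axioms)

text \<open>Every subspace is the kernel of a linear map, namely of the identity minus a projection onto
  the subspace. Such a map represents the quotient by the subspace inside the given type.\<close>

lemma ex_linear_with_kernel:
  fixes B :: "'s chain set"
  assumes "chains.subspace B"
  obtains f :: "'s chain \<Rightarrow> 's chain" where "chain_linear f" "\<And>x. f x = 0 \<longleftrightarrow> x \<in> B"
proof -
  have "chain_linear (\<lambda>x :: 's chain. x)"
    by (rule chains.linear_ident)
  then obtain g :: "'s chain \<Rightarrow> 's chain" where g: "range g \<subseteq> B" "chain_linear g" "\<forall>v\<in>B. g v = v"
    using chain_pair.linear_exists_left_inverse_on[of "\<lambda>x. x" B] assms by auto
  show thesis
  proof
    show "chain_linear (\<lambda>x. x - g x)"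
      by (intro chain_pair.linear_compose_sub chains.linear_ident g(2))
    show "x - g x = 0 \<longleftrightarrow> x \<in> B" for x
      using g by (metis eq_iff_diff_eq_0 rangeI subsetD)
  qed
qed

text \<open>An injective linear map from a module record to a space of chains. Since the module laws
  follow from those for chains, they need not be assumed.\<close>

locale linear_embedding =
  fixes V :: "(complex, 'v, 'x) module_scheme" and T :: "'v \<Rightarrow> 'w chain"
  assumes zero_mem: "\<zero>\<^bsub>V\<^esub> \<in> carrier V"
    and add_mem: "\<lbrakk>x \<in> carrier V; y \<in> carrier V\<rbrakk> \<Longrightarrow> x \<oplus>\<^bsub>V\<^esub> y \<in> carrier V"
    and smult_mem: "x \<in> carrier V \<Longrightarrow> z \<odot>\<^bsub>V\<^esub> x \<in> carrier V"
    and T_inj: "inj_on T (carrier V)"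
    and T_zero: "T \<zero>\<^bsub>V\<^esub> = 0"
    and T_add: "\<lbrakk>x \<in> carrier V; y \<in> carrier V\<rbrakk> \<Longrightarrow> T (x \<oplus>\<^bsub>V\<^esub> y) = T x + T y"
    and T_smult: "x \<in> carrier V \<Longrightarrow> T (z \<odot>\<^bsub>V\<^esub> x) = scl z (T x)"
begin

lemma T_eqD: "\<lbrakk>T x = T y; x \<in> carrier V; y \<in> carrier V\<rbrakk> \<Longrightarrow> x = y"
  using T_inj by (auto dest: inj_onD)

lemma is_vectorspace: "vectorspace class_ring V"
proof -
  note mems = zero_mem add_mem smult_mem
  have "\<exists>y\<in>carrier V. x \<oplus>\<^bsub>V\<^esub> y = \<zero>\<^bsub>V\<^esub>" if "x \<in> carrier V" for x
  proof
    have "T x + scl (-1) (T x) = 0"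
      by (intro poly_mapping_eqI) (simp add: lookup_add)
    with that show "x \<oplus>\<^bsub>V\<^esub> (-1) \<odot>\<^bsub>V\<^esub> x = \<zero>\<^bsub>V\<^esub>"
      by (intro T_eqD) (simp_all add: T_add T_smult T_zero mems)
  qed (simp add: mems that)
  moreover have "field (class_ring :: complex ring)"
    by (rule class_field)
  ultimately show ?thesis
  proof (intro vs_criteria, goal_cases)
    case 6
    show ?case
      by (auto intro!: T_eqD simp: T_add mems add.commute)
  next
    case 7
    show ?case
      by (auto intro!: T_eqD simp: T_add mems add.assoc)
  qed (auto intro!: T_eqD simp: T_add T_smult T_zero mems
    chains.scale_left_distrib chains.scale_right_distrib)
qed

interpretation vectorspace class_ring V
  by (rule is_vectorspace)

lemma subspace_image: "chains.subspace (T ` carrier V)"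
proof (rule chains.subspaceI)
  show "0 \<in> T ` carrier V"
    using T_zero zero_mem by force
  show "x + y \<in> T ` carrier V" if "x \<in> T ` carrier V" "y \<in> T ` carrier V" for x y
    using that by (auto simp: T_add[symmetric] add_mem)
  show "scl z x \<in> T ` carrier V" if "x \<in> T ` carrier V" for z x
    using that by (auto simp: T_smult[symmetric] smult_mem)
qed

lemma T_lincomb:
  assumes "finite A" "A \<subseteq> carrier V"
  shows "T (lincomb a A) = (\<Sum>v\<in>A. scl (a v) (T v))"
proof -
  have "finsum V (\<lambda>v. a v \<odot>\<^bsub>V\<^esub> v) A \<in> carrier V
      \<and> T (finsum V (\<lambda>v. a v \<odot>\<^bsub>V\<^esub> v) A) = (\<Sum>v\<in>A. scl (a v) (T v))"
    using assms
  proof (induction A)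
    case (insert v A)
    then have "finsum V (\<lambda>v. a v \<odot>\<^bsub>V\<^esub> v) (insert v A) = a v \<odot>\<^bsub>V\<^esub> v \<oplus>\<^bsub>V\<^esub> finsum V (\<lambda>v. a v \<odot>\<^bsub>V\<^esub> v) A"
      by (intro M.finsum_insert) (auto intro: smult_mem)
    with insert show ?case
      by (auto simp: T_add T_smult add_mem smult_mem)
  qed (auto simp: T_zero)
  then show ?thesis
    by (simp add: lincomb_def)
qed

lemma lincomb_mem: "A \<subseteq> carrier V \<Longrightarrow> lincomb a A \<in> carrier V"
  by (auto intro!: lincomb_closed)

lemma sum_image_T:
  assumes "A \<subseteq> carrier V"
  shows "(\<Sum>w\<in>T ` A. scl (a w) w) = (\<Sum>v\<in>A. scl (a (T v)) (T v))"
  using inj_on_subset[OF T_inj assms] by (simp add: sum.reindex)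

lemma lin_dep_iff:
  assumes "A \<subseteq> carrier V"
  shows "lin_dep A \<longleftrightarrow> chains.dependent (T ` A)"
proof
  assume "lin_dep A"
  then obtain S a v where S: "finite S" "S \<subseteq> A" "lincomb a S = \<zero>\<^bsub>V\<^esub>" "v \<in> S" "a v \<noteq> 0"
    unfolding lin_dep_def by auto
  with assms have inj: "inj_on T S" and SV: "S \<subseteq> carrier V"
    by (auto intro: inj_on_subset[OF T_inj])
  let ?u = "\<lambda>w. a (the_inv_into S T w)"
  have "(\<Sum>w\<in>T ` S. scl (?u w) w) = (\<Sum>v\<in>S. scl (a v) (T v))"
    using SV inj by (simp add: sum_image_T the_inv_into_f_f cong: sum.cong)
  also have "\<dots> = 0"
    using T_lincomb[OF S(1) SV, of a] S(3) by (simp add: T_zero)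
  finally show "chains.dependent (T ` A)"
    unfolding chains.dependent_explicit using S inj
    by (intro exI[of _ "T ` S"] exI[of _ ?u]) (auto intro!: bexI[of _ v] simp: the_inv_into_f_f)
next
  assume "chains.dependent (T ` A)"
  then obtain S' u w where S': "finite S'" "S' \<subseteq> T ` A" "w \<in> S'" "u w \<noteq> 0" "(\<Sum>w\<in>S'. scl (u w) w) = 0"
    unfolding chains.dependent_explicit by blast
  then obtain S where S: "finite S" "S \<subseteq> A" "S' = T ` S"
    by (meson finite_subset_image)
  then have SV: "S \<subseteq> carrier V"
    using assms by blast
  then have "T (lincomb (u \<circ> T) S) = T \<zero>\<^bsub>V\<^esub>"
    using S S' by (simp add: T_lincomb T_zero sum_image_T)
  then have "lincomb (u \<circ> T) S = \<zero>\<^bsub>V\<^esub>"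
    by (intro T_eqD lincomb_mem SV zero_mem)
  with S S' show "lin_dep A"
    unfolding lin_dep_def by force
qed

lemma image_span:
  assumes "A \<subseteq> carrier V"
  shows "T ` span A = chains.span (T ` A)"
proof (intro subset_antisym subsetI)
  fix w assume "w \<in> T ` span A"
  then obtain S a where S: "finite S" "S \<subseteq> A" "w = T (lincomb a S)"
    unfolding span_def by blast
  with assms have "w = (\<Sum>v\<in>S. scl (a v) (T v))"
    by (simp add: T_lincomb)
  also have "\<dots> \<in> chains.span (T ` A)"
    using S(2) by (intro chains.span_sum chains.span_scale chains.span_base) auto
  finally show "w \<in> chains.span (T ` A)" .
next
  fix w assume "w \<in> chains.span (T ` A)"
  then obtain S' u where S': "finite S'" "S' \<subseteq> T ` A" "w = (\<Sum>w\<in>S'. scl (u w) w)"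
    unfolding chains.span_explicit by blast
  then obtain S where S: "finite S" "S \<subseteq> A" "S' = T ` S"
    by (meson finite_subset_image)
  then have "w = T (lincomb (u \<circ> T) S)"
    using S' assms by (simp add: T_lincomb sum_image_T)
  then show "w \<in> T ` span A"
    using S unfolding span_def by auto
qed

lemma basis_iff:
  "basis A \<longleftrightarrow> A \<subseteq> carrier V \<and> chains.independent (T ` A) \<and> chains.span (T ` A) = T ` carrier V"
proof (cases "A \<subseteq> carrier V")
  case True
  then have "span A \<subseteq> carrier V"
    by (rule span_is_subset2)
  then have "span A = carrier V \<longleftrightarrow> T ` span A = T ` carrier V"
    by (metis T_inj inj_on_image_eq_iff subset_refl)
  with True show ?thesis
    by (auto simp: basis_def lin_dep_iff image_span)
qed (auto simp: basis_def)

lemma basis_exists: "\<exists>A. basis A"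
proof -
  obtain C where C: "C \<subseteq> T ` carrier V" "chains.independent C" "T ` carrier V \<subseteq> chains.span C"
    using chains.maximal_independent_subset .
  moreover have "chains.span C \<subseteq> T ` carrier V"
    using C(1) subspace_image by (rule chains.span_minimal)
  moreover obtain A where "A \<subseteq> carrier V" "C = T ` A"
    using C(1) by (auto simp: subset_image_iff)
  ultimately show ?thesis
    by (auto simp: basis_iff)
qed

lemma vs_dim_basis: "\<exists>A. basis A \<and> vs_dim V = |A|"
  unfolding vs_dim_def using someI_ex[OF basis_exists] by blast

end

text \<open>Two spaces that embed onto the same subspace have the same dimension, whichever bases
  \<open>vs_dim\<close> picks in them.\<close>

lemma vs_dim_eqI:
  fixes T :: "'v \<Rightarrow> 'w chain" and U :: "'u \<Rightarrow> 'w chain"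
  assumes V: "linear_embedding V T" and W: "linear_embedding W U"
    and eq: "T ` carrier V = U ` carrier W"
  shows "vs_dim V =o vs_dim W"
proof -
  interpret V: linear_embedding V T by fact
  interpret W: linear_embedding W U by fact
  obtain A where A: "vectorspace.basis class_ring V A" "vs_dim V = |A|"
    using V.vs_dim_basis by blast
  obtain B where B: "vectorspace.basis class_ring W B" "vs_dim W = |B|"
    using W.vs_dim_basis by blast
  have "\<exists>f. bij_betw f (T ` A) (U ` B)"
    using A(1) B(1) eq by (intro chains.bij_if_span_eq_span_bases) (auto simp: V.basis_iff W.basis_iff)
  then obtain f where "bij_betw f (T ` A) (U ` B)" ..
  moreover have "bij_betw T A (T ` A)" "bij_betw U B (U ` B)"
    using A(1) B(1) V.T_inj W.T_inj
    by (auto simp: V.basis_iff W.basis_iff bij_betw_def intro: inj_on_subset)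
  ultimately have "bij_betw (the_inv_into B U \<circ> (f \<circ> T)) A B"
    by (meson bij_betw_the_inv_into bij_betw_trans)
  then show ?thesis
    unfolding A(2) B(2) card_of_ordIso[symmetric] by blast
qed

section \<open>Quotients of chain spaces\<close>

text \<open>The coset of \<open>x\<close>, with the elements of \<open>B\<close> on the left as in \<open>a_rcosets\<close>.\<close>

definition coset :: "'s chain set \<Rightarrow> 's chain \<Rightarrow> 's chain set" where
  "coset B x = (\<lambda>b. b + x) ` B"

lemma coset_eq_iff:
  assumes "chains.subspace B"
  shows "coset B x = coset B y \<longleftrightarrow> x - y \<in> B"
proof
  assume "coset B x = coset B y"
  moreover have "x \<in> coset B x"
    using chains.subspace_0[OF assms] by (force simp: coset_def)
  ultimately show "x - y \<in> B"
    by (auto simp: coset_def)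
next
  have *: "coset B x \<subseteq> coset B y" if "x - y \<in> B" for x y
  proof
    fix z assume "z \<in> coset B x"
    then obtain b where "b \<in> B" "z = b + x"
      by (auto simp: coset_def)
    then have "b + (x - y) \<in> B" "z = (b + (x - y)) + y"
      using chains.subspace_add[OF assms] that by auto
    then show "z \<in> coset B y"
      unfolding coset_def by blast
  qed
  assume "x - y \<in> B"
  moreover from this have "y - x \<in> B"
    using chains.subspace_neg[OF assms] by force
  ultimately show "coset B x = coset B y"
    using * by blast
qed

lemma coset_zero: "coset B 0 = B"
  by (simp add: coset_def)

text \<open>The record \<open>V\<close> is the image of \<open>Z\<close> in the quotient by \<open>B\<close>; \<open>Z\<close> need not contain \<open>B\<close>. A linear
  map that vanishes on \<open>B\<close> takes only one value on each coset, which \<open>the_elem\<close> extracts.\<close>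

lemma linear_embedding_quotient:
  fixes f :: "'s chain \<Rightarrow> 't chain"
  assumes B: "chains.subspace B" and Z: "chains.subspace Z" and f: "chain_linear f"
    and f_0: "\<And>x. x \<in> B \<Longrightarrow> f x = 0" and f_inj: "\<And>x. x \<in> Z \<Longrightarrow> f x = 0 \<Longrightarrow> x \<in> B"
    and carr: "carrier V = coset B ` Z" and zero: "\<zero>\<^bsub>V\<^esub> = B"
    and add: "\<And>x y. coset B x \<oplus>\<^bsub>V\<^esub> coset B y = coset B (x + y)"
    and smult: "\<And>z x. z \<odot>\<^bsub>V\<^esub> coset B x = coset B (scl z x)"
  shows "linear_embedding V (\<lambda>C. the_elem (f ` C))" "(\<lambda>C. the_elem (f ` C)) ` carrier V = f ` Z"
proof -
  interpret f: Vector_Spaces.linear scl scl f by fact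
  have *: "the_elem (f ` coset B x) = f x" for x
  proof -
    have "f ` coset B x = {f x}"
      using chains.subspace_0[OF B] by (force simp: coset_def f.add f_0)
    then show ?thesis by simp
  qed
  have mem: "coset B 0 \<in> coset B ` Z"
    using chains.subspace_0[OF Z] by blast
  show "linear_embedding V (\<lambda>C. the_elem (f ` C))"
  proof
    show "inj_on (\<lambda>C. the_elem (f ` C)) (carrier V)"
    proof (rule inj_onI, unfold carr, clarify)
      fix x y assume "x \<in> Z" "y \<in> Z" "the_elem (f ` coset B x) = the_elem (f ` coset B y)"
      then show "coset B x = coset B y"
        using f_inj[of "x - y"] by (simp add: * f.diff coset_eq_iff[OF B] chains.subspace_diff[OF Z])
    qed
    show "the_elem (f ` \<zero>\<^bsub>V\<^esub>) = 0"
      using *[of 0] by (simp add: zero coset_zero f.zero)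
  qed (use mem in \<open>auto simp: carr zero add smult * f.add f.scale coset_zero
      chains.subspace_add[OF Z] chains.subspace_scale[OF Z]\<close>)
  show "(\<lambda>C. the_elem (f ` C)) ` carrier V = f ` Z"
    by (simp add: carr image_image *)
qed

section \<open>Chain maps, boundaries and homology\<close>

text \<open>The chains with support in \<open>S\<close>. For the set of \<open>n\<close>-simplices this is the space of
  \<open>n\<close>-chains.\<close>

definition supported :: "'s set \<Rightarrow> 's chain set" where
  "supported S = {c. Poly_Mapping.keys c \<subseteq> S}"

lemma subspace_supported: "chains.subspace (supported S)"
proof (rule chains.subspaceI)
  show "scl z c \<in> supported S" if "c \<in> supported S" for z c
    using that by (auto simp: supported_def in_keys_iff subset_iff)
  show "x + y \<in> supported S" if "x \<in> supported S" "y \<in> supported S" for x y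
    using that Poly_Mapping.keys_add[of x y] by (auto simp: supported_def)
qed (simp add: supported_def)

lemma single_supported: "s \<in> S \<Longrightarrow> Poly_Mapping.single s z \<in> supported S"
  by (auto simp: supported_def)

lemma chain_expansion:
  "c = (\<Sum>s\<in>Poly_Mapping.keys c. scl (Poly_Mapping.lookup c s) (Poly_Mapping.single s 1))"
  by (intro poly_mapping_eqI) (auto simp: lookup_sum lookup_single when_def in_keys_iff sum.delta)

lemma linear_eq_on_supported:
  fixes f g :: "'s chain \<Rightarrow> 't chain"
  assumes f: "chain_linear f" and g: "chain_linear g" and c: "c \<in> supported S"
    and eq: "\<And>s. s \<in> S \<Longrightarrow> f (Poly_Mapping.single s 1) = g (Poly_Mapping.single s 1)"
  shows "f c = g c"
proof -
  interpret f: Vector_Spaces.linear scl scl f by fact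
  interpret g: Vector_Spaces.linear scl scl g by fact
  show ?thesis
    using c by (subst (1 2) chain_expansion[of c])
      (auto simp: f.sum g.sum f.scale g.scale eq supported_def simp del: map_single intro!: sum.cong)
qed

lemma linear_supported_into:
  fixes f :: "'s chain \<Rightarrow> 't chain"
  assumes f: "chain_linear f" and W: "chains.subspace W" and c: "c \<in> supported S"
    and mem: "\<And>s. s \<in> S \<Longrightarrow> f (Poly_Mapping.single s 1) \<in> W"
  shows "f c \<in> W"
proof -
  interpret f: Vector_Spaces.linear scl scl f by fact
  show ?thesis
    using c by (subst chain_expansion[of c])
      (auto simp: f.sum f.scale supported_def simp del: map_single
        intro!: chains.subspace_sum chains.subspace_scale W mem)
qed

text \<open>The linear extension of a map defined on the basis; chain maps and boundaries have this form.\<close>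

definition lin_ext :: "('s \<Rightarrow> 't chain) \<Rightarrow> 's chain \<Rightarrow> 't chain" where
  "lin_ext f c = (\<Sum>s\<in>Poly_Mapping.keys c. scl (Poly_Mapping.lookup c s) (f s))"

lemma lin_ext_eq:
  assumes "finite S" "Poly_Mapping.keys c \<subseteq> S"
  shows "lin_ext f c = (\<Sum>s\<in>S. scl (Poly_Mapping.lookup c s) (f s))"
  unfolding lin_ext_def using assms
  by (intro sum.mono_neutral_left) (auto simp: in_keys_iff)

lemma lin_ext_linear:
  fixes f :: "'s \<Rightarrow> 't chain"
  shows "chain_linear (lin_ext f)"
proof (rule chain_linearI)
  fix c d :: "'s chain"
  let ?S = "Poly_Mapping.keys c \<union> Poly_Mapping.keys d"
  show "lin_ext f (c + d) = lin_ext f c + lin_ext f d"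
    using Poly_Mapping.keys_add[of c d]
    by (simp add: lin_ext_eq[of ?S] lookup_add chains.scale_left_distrib sum.distrib)
next
  fix z and c :: "'s chain"
  have "Poly_Mapping.keys (scl z c) \<subseteq> Poly_Mapping.keys c"
    by (auto simp: in_keys_iff)
  then show "lin_ext f (scl z c) = scl z (lin_ext f c)"
    by (simp add: lin_ext_eq[of "Poly_Mapping.keys c"] chains.scale_sum_right)
qed

lemma lin_ext_single: "lin_ext f (Poly_Mapping.single s 1) = f s"
  by (simp add: lin_ext_def)

lemma chain_map_lin_ext: "chain_map \<phi> = lin_ext (\<lambda>s. Poly_Mapping.single (\<phi> s) 1)"
  by (simp add: fun_eq_iff chain_map_def lin_ext_def)

lemma chain_map_linear: "chain_linear (chain_map \<phi>)"
  by (simp add: chain_map_lin_ext lin_ext_linear)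

lemma chain_map_single: "chain_map \<phi> (Poly_Mapping.single s 1) = Poly_Mapping.single (\<phi> s) 1"
  by (simp add: chain_map_lin_ext lin_ext_single)

lemma chain_map_supported:
  assumes "\<And>s. s \<in> S \<Longrightarrow> \<phi> s \<in> S'" "c \<in> supported S"
  shows "chain_map \<phi> c \<in> supported S'"
  by (rule linear_supported_into[OF chain_map_linear subspace_supported assms(2)])
    (simp add: chain_map_single single_supported assms(1))

lemma boundary_Suc:
  "boundary X (Suc n) =
    lin_ext (\<lambda>s. \<Sum>i\<le>Suc n. Poly_Mapping.single (face X (Suc n) i s) ((-1) ^ i))"
proof -
  have "scl z (\<Sum>i\<le>Suc n. Poly_Mapping.single (face X (Suc n) i s) ((-1) ^ i))
      = (\<Sum>i\<le>Suc n. Poly_Mapping.single (face X (Suc n) i s) ((-1) ^ i * z))" for z s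
    unfolding chains.scale_sum_right by (simp add: mult.commute)
  then show ?thesis
    unfolding boundary_def lin_ext_def fun_eq_iff by simp
qed

lemma boundary_linear: "chain_linear (boundary X n)"
proof (cases n)
  case 0
  then have "boundary X n = (\<lambda>c. 0)"
    by (auto simp: boundary_def)
  then show ?thesis
    by (simp add: chain_linearI)
qed (simp add: boundary_Suc lin_ext_linear)

lemma boundary_supported:
  assumes "\<And>s i. \<lbrakk>s \<in> simplices X (Suc n); i \<le> Suc n\<rbrakk> \<Longrightarrow> face X (Suc n) i s \<in> simplices X n"
    and "c \<in> supported (simplices X (Suc n))"
  shows "boundary X (Suc n) c \<in> supported (simplices X n)"
proof (rule linear_supported_into[OF boundary_linear subspace_supported assms(2)])
  show "boundary X (Suc n) (Poly_Mapping.single s 1) \<in> supported (simplices X n)"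
    if "s \<in> simplices X (Suc n)" for s
    unfolding boundary_Suc lin_ext_single using that
    by (intro chains.subspace_sum subspace_supported single_supported assms(1)) simp_all
qed

lemma chain_map_boundary:
  assumes "\<And>s i. \<lbrakk>s \<in> simplices X (Suc n); i \<le> Suc n\<rbrakk>
      \<Longrightarrow> \<phi> (face X (Suc n) i s) = face Y (Suc n) i (\<phi> s)"
    and "c \<in> supported (simplices X (Suc n))"
  shows "chain_map \<phi> (boundary X (Suc n) c) = boundary Y (Suc n) (chain_map \<phi> c)"
proof -
  interpret \<phi>: Vector_Spaces.linear scl scl "chain_map \<phi>" by (rule chain_map_linear)
  have *: "chain_map \<phi> (Poly_Mapping.single s z) = Poly_Mapping.single (\<phi> s) z" for s z
    by (simp add: chain_map_def)
  have "chain_linear (\<lambda>c. chain_map \<phi> (boundary X (Suc n) c))"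
    "chain_linear (\<lambda>c. boundary Y (Suc n) (chain_map \<phi> c))"
    using Vector_Spaces.linear_compose[OF boundary_linear chain_map_linear]
      Vector_Spaces.linear_compose[OF chain_map_linear boundary_linear]
    by (auto simp: o_def)
  then show ?thesis
    by (rule linear_eq_on_supported[OF _ _ assms(2)])
      (auto simp: boundary_Suc lin_ext_single chain_map_single \<phi>.sum * assms(1) simp del: sum.atMost_Suc
        intro!: sum.cong)
qed

lemma carrier_chain_module: "carrier (chain_module X n) = supported (simplices X n)"
  by (simp add: chain_module_def supported_def)

lemma subspace_cycles: "chains.subspace (cycles X n)"
proof -
  interpret d: Vector_Spaces.linear scl scl "boundary X n" by (rule boundary_linear)
  show ?thesis
    using chains.subspace_inter[OF subspace_supported[of "simplices X n"] d.subspace_kernel]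
    unfolding cycles_def carrier_chain_module by (simp add: Int_def)
qed

lemma subspace_boundaries: "chains.subspace (boundaries X n)"
proof -
  interpret d: Vector_Spaces.linear scl scl "boundary X (Suc n)" by (rule boundary_linear)
  show ?thesis
    unfolding boundaries_def carrier_chain_module by (rule d.subspace_image[OF subspace_supported])
qed

text \<open>The operations on homology, and the maps induced on it, are defined by sums of sets. The next
  two lemmas identify these sums as cosets.\<close>

lemma set_sum_coset:
  assumes "chains.subspace B"
  shows "(\<Union>h\<in>coset B x. \<Union>k\<in>coset B y. {h + k}) = coset B (x + y)"
proof (intro subset_antisym subsetI)
  fix w assume "w \<in> (\<Union>h\<in>coset B x. \<Union>k\<in>coset B y. {h + k})"
  then obtain b c where "b \<in> B" "c \<in> B" "w = (b + c) + (x + y)"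
    by (auto simp: coset_def algebra_simps)
  then show "w \<in> coset B (x + y)"
    using chains.subspace_add[OF assms] by (auto simp: coset_def)
next
  fix w assume "w \<in> coset B (x + y)"
  then obtain b where "b \<in> B" "w = (b + x) + (0 + y)"
    by (auto simp: coset_def algebra_simps)
  then show "w \<in> (\<Union>h\<in>coset B x. \<Union>k\<in>coset B y. {h + k})"
    using chains.subspace_0[OF assms] unfolding coset_def by blast
qed

lemma set_sum_image_coset:
  fixes f :: "'s chain \<Rightarrow> 't chain"
  assumes B: "chains.subspace B" and B': "chains.subspace B'"
    and f: "chain_linear f" and f_B: "\<And>b. b \<in> B \<Longrightarrow> f b \<in> B'"
  shows "(\<Union>h\<in>B'. \<Union>k\<in>f ` coset B x. {h + k}) = coset B' (f x)"
proof -
  interpret f: Vector_Spaces.linear scl scl f by fact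
  show ?thesis
  proof (intro subset_antisym subsetI)
    fix w assume "w \<in> (\<Union>h\<in>B'. \<Union>k\<in>f ` coset B x. {h + k})"
    then obtain h b where "h \<in> B'" "b \<in> B" "w = (h + f b) + f x"
      by (auto simp: coset_def f.add add.assoc)
    then show "w \<in> coset B' (f x)"
      using chains.subspace_add[OF B'] f_B by (auto simp: coset_def)
  next
    fix w assume "w \<in> coset B' (f x)"
    then obtain h where "h \<in> B'" "w = h + f (0 + x)"
      by (auto simp: coset_def)
    then show "w \<in> (\<Union>h\<in>B'. \<Union>k\<in>f ` coset B x. {h + k})"
      using chains.subspace_0[OF B] unfolding coset_def by blast
  qed
qed

lemma carrier_homology: "carrier (homology X n) = coset (boundaries X n) ` cycles X n"
  by (auto simp: homology_def quotient_module_def A_RCOSETS_def RCOSETS_def r_coset_def coset_def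
      chain_module_def)

lemma zero_homology: "\<zero>\<^bsub>homology X n\<^esub> = boundaries X n"
  by (simp add: homology_def quotient_module_def)

lemma add_homology:
  "coset (boundaries X n) x \<oplus>\<^bsub>homology X n\<^esub> coset (boundaries X n) y = coset (boundaries X n) (x + y)"
  using set_sum_coset[OF subspace_boundaries]
  by (simp add: homology_def quotient_module_def set_add_def set_mult_def chain_module_def)

lemma smult_homology:
  "z \<odot>\<^bsub>homology X n\<^esub> coset (boundaries X n) x = coset (boundaries X n) (scl z x)"
  using set_sum_image_coset[OF subspace_boundaries subspace_boundaries chains.linear_scale_self
      chains.subspace_scale[OF subspace_boundaries]]
  by (simp add: homology_def quotient_module_def set_add_def set_mult_def chain_module_def)

lemma homology_map_coset:
  assumes "\<And>b. b \<in> boundaries X n \<Longrightarrow> chain_map \<phi> b \<in> boundaries Y n"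
  shows "homology_map Y n \<phi> (coset (boundaries X n) x) = coset (boundaries Y n) (chain_map \<phi> x)"
  using set_sum_image_coset[OF subspace_boundaries subspace_boundaries chain_map_linear assms]
  by (simp add: homology_map_def set_add_def set_mult_def chain_module_def)

section \<open>Homology of the quotient of a simplicial set by a finite group\<close>

text \<open>The simplicial map \<open>p\<close> exhibits \<open>Y\<close> as the quotient of \<open>X\<close> by the action \<open>\<phi>\<close> of \<open>G\<close>: in each
  degree it is onto and its fibres are the orbits.\<close>

locale simplicial_quotient = group G for G :: "('g, 'x) monoid_scheme" +
  fixes X :: "'s sset" and Y :: "'t sset" and \<phi> :: "'g \<Rightarrow> 's \<Rightarrow> 's" and p :: "'s \<Rightarrow> 't"
  assumes finite_G: "finite (carrier G)"
    and act_closed: "\<lbrakk>g \<in> carrier G; s \<in> simplices X n\<rbrakk> \<Longrightarrow> \<phi> g s \<in> simplices X n"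
    and act_mult: "\<lbrakk>g \<in> carrier G; h \<in> carrier G; s \<in> simplices X n\<rbrakk>
      \<Longrightarrow> \<phi> (g \<otimes>\<^bsub>G\<^esub> h) s = \<phi> g (\<phi> h s)"
    and face_closed: "\<lbrakk>s \<in> simplices X (Suc n); i \<le> Suc n\<rbrakk> \<Longrightarrow> face X (Suc n) i s \<in> simplices X n"
    and act_face: "\<lbrakk>g \<in> carrier G; s \<in> simplices X (Suc n); i \<le> Suc n\<rbrakk>
      \<Longrightarrow> \<phi> g (face X (Suc n) i s) = face X (Suc n) i (\<phi> g s)"
    and p_face: "\<lbrakk>s \<in> simplices X (Suc n); i \<le> Suc n\<rbrakk>
      \<Longrightarrow> p (face X (Suc n) i s) = face Y (Suc n) i (p s)"
    and p_onto: "p ` simplices X n = simplices Y n"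
    and p_fibres: "\<lbrakk>s \<in> simplices X n; t \<in> simplices X n\<rbrakk>
      \<Longrightarrow> p s = p t \<longleftrightarrow> (\<exists>g\<in>carrier G. \<phi> g s = t)"
begin

abbreviation C :: "nat \<Rightarrow> 's chain set" where "C n \<equiv> supported (simplices X n)"
abbreviation D :: "nat \<Rightarrow> 't chain set" where "D n \<equiv> supported (simplices Y n)"
abbreviation act :: "'g \<Rightarrow> 's chain \<Rightarrow> 's chain" where "act g \<equiv> chain_map (\<phi> g)"
abbreviation proj :: "'s chain \<Rightarrow> 't chain" where "proj \<equiv> chain_map p"

text \<open>The action of the norm element, the sum of all elements of \<open>G\<close> in the group ring.\<close>

definition norm_map :: "'s chain \<Rightarrow> 's chain" where
  "norm_map c = (\<Sum>g\<in>carrier G. act g c)"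

sublocale act: Vector_Spaces.linear scl scl "act g" for g by (rule chain_map_linear)
sublocale proj: Vector_Spaces.linear scl scl proj by (rule chain_map_linear)
sublocale bdX: Vector_Spaces.linear scl scl "boundary X n" for n by (rule boundary_linear)
sublocale bdY: Vector_Spaces.linear scl scl "boundary Y n" for n by (rule boundary_linear)

lemma norm_linear: "chain_linear norm_map"
  unfolding norm_map_def by (intro chain_pair.linear_compose_sum) (simp add: act.linear_axioms)

sublocale norm_map: Vector_Spaces.linear scl scl norm_map by (rule norm_linear)

lemma act_C: "\<lbrakk>g \<in> carrier G; c \<in> C n\<rbrakk> \<Longrightarrow> act g c \<in> C n"
  by (rule chain_map_supported) (auto intro: act_closed)

lemma proj_C: "c \<in> C n \<Longrightarrow> proj c \<in> D n"
  by (rule chain_map_supported) (use p_onto in auto)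

lemma norm_C: "c \<in> C n \<Longrightarrow> norm_map c \<in> C n"
  unfolding norm_map_def by (intro chains.subspace_sum subspace_supported act_C)

lemma act_bd: "\<lbrakk>g \<in> carrier G; c \<in> C (Suc n)\<rbrakk>
    \<Longrightarrow> act g (boundary X (Suc n) c) = boundary X (Suc n) (act g c)"
  by (rule chain_map_boundary) (auto simp: act_face)

lemma norm_bd: "c \<in> C (Suc n) \<Longrightarrow> norm_map (boundary X (Suc n) c) = boundary X (Suc n) (norm_map c)"
  by (simp add: norm_map_def act_bd bdX.sum)

lemma proj_bd: "c \<in> C (Suc n) \<Longrightarrow> proj (boundary X (Suc n) c) = boundary Y (Suc n) (proj c)"
  by (rule chain_map_boundary) (auto simp: p_face)

lemma bd_C: "c \<in> C (Suc n) \<Longrightarrow> boundary X (Suc n) c \<in> C n"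
  by (rule boundary_supported) (auto intro: face_closed)

lemma proj_act:
  assumes "g \<in> carrier G" "c \<in> C n"
  shows "proj (act g c) = proj c"
proof (rule linear_eq_on_supported[OF _ proj.linear_axioms assms(2)])
  show "chain_linear (\<lambda>c. proj (act g c))"
    using Vector_Spaces.linear_compose[OF act.linear_axioms proj.linear_axioms] by (simp add: o_def)
  show "proj (act g (Poly_Mapping.single s 1)) = proj (Poly_Mapping.single s 1)"
    if s: "s \<in> simplices X n" for s
    using p_fibres[OF s act_closed[OF assms(1) s]] assms(1) by (auto simp: chain_map_single)
qed

lemma proj_norm:
  assumes "c \<in> C n"
  shows "proj (norm_map c) = scl (of_nat (Coset.order G)) (proj c)"
proof -
  have "proj (norm_map c) = (\<Sum>g\<in>carrier G. proj c)"
    unfolding norm_map_def proj.sum by (intro sum.cong refl proj_act[OF _ assms])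
  then show ?thesis
    by (intro poly_mapping_eqI) (simp add: lookup_sum Coset.order_def)
qed

text \<open>Left and right translation by a group element permute the summands of the norm.\<close>

lemma norm_single_act:
  assumes h: "h \<in> carrier G" and s: "s \<in> simplices X n"
  shows "norm_map (Poly_Mapping.single (\<phi> h s) 1) = norm_map (Poly_Mapping.single s 1)"
proof -
  have "norm_map (Poly_Mapping.single (\<phi> h s) 1)
      = (\<Sum>g\<in>carrier G. Poly_Mapping.single (\<phi> (g \<otimes>\<^bsub>G\<^esub> h) s) 1)"
    using h s by (simp add: norm_map_def chain_map_single act_mult)
  also have "\<dots> = (\<Sum>g\<in>carrier G. Poly_Mapping.single (\<phi> g s) 1)"
    by (rule sum.reindex_bij_witness[of _ "\<lambda>g. g \<otimes>\<^bsub>G\<^esub> inv\<^bsub>G\<^esub> h" "\<lambda>g. g \<otimes>\<^bsub>G\<^esub> h"])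
      (auto simp: h m_assoc)
  finally show ?thesis
    by (simp add: norm_map_def chain_map_single)
qed

lemma act_norm:
  assumes h: "h \<in> carrier G" and c: "c \<in> C n"
  shows "act h (norm_map c) = norm_map c"
proof (rule linear_eq_on_supported[OF _ norm_linear c])
  show "chain_linear (\<lambda>c. act h (norm_map c))"
    using Vector_Spaces.linear_compose[OF norm_linear act.linear_axioms] by (simp add: o_def)
  fix s assume s: "s \<in> simplices X n"
  have "act h (norm_map (Poly_Mapping.single s 1))
      = (\<Sum>g\<in>carrier G. Poly_Mapping.single (\<phi> (h \<otimes>\<^bsub>G\<^esub> g) s) 1)"
    using h s by (simp add: norm_map_def chain_map_single act_mult act.sum)
  also have "\<dots> = (\<Sum>g\<in>carrier G. Poly_Mapping.single (\<phi> g s) 1)"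
    by (rule sum.reindex_bij_witness[of _ "\<lambda>g. inv\<^bsub>G\<^esub> h \<otimes>\<^bsub>G\<^esub> g" "\<lambda>g. h \<otimes>\<^bsub>G\<^esub> g"])
      (auto simp: h m_assoc[symmetric])
  finally show "act h (norm_map (Poly_Mapping.single s 1)) = norm_map (Poly_Mapping.single s 1)"
    by (simp add: norm_map_def chain_map_single)
qed

text \<open>A linear section of the projection. It depends on a choice of simplices and is in general not a
  chain map.\<close>

abbreviation sect :: "nat \<Rightarrow> 't chain \<Rightarrow> 's chain" where
  "sect n \<equiv> chain_map (inv_into (simplices X n) p)"

lemma sect_D: "d \<in> D n \<Longrightarrow> sect n d \<in> C n"
  by (rule chain_map_supported) (auto simp: p_onto[symmetric] inv_into_into)

lemma proj_sect:
  assumes "d \<in> D n"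
  shows "proj (sect n d) = d"
proof (rule linear_eq_on_supported[OF _ _ assms])
  show "chain_linear (\<lambda>d. proj (sect n d))"
    using Vector_Spaces.linear_compose[OF chain_map_linear proj.linear_axioms] by (simp add: o_def)
  show "chain_linear (\<lambda>d :: 't chain. d)"
    by (rule chains.linear_ident)
  show "proj (sect n (Poly_Mapping.single t 1)) = Poly_Mapping.single t 1" if "t \<in> simplices Y n" for t
    using that unfolding chain_map_single p_onto[symmetric] by (simp add: f_inv_into_f)
qed

text \<open>The norm factors through the projection, because a simplex and the chosen simplex over its
  image lie in one orbit. This is the transfer homomorphism.\<close>

lemma norm_sect_proj:
  assumes "c \<in> C n"
  shows "norm_map (sect n (proj c)) = norm_map c"
proof (rule linear_eq_on_supported[OF _ norm_linear assms])
  show "chain_linear (\<lambda>c. norm_map (sect n (proj c)))"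
    using Vector_Spaces.linear_compose[OF Vector_Spaces.linear_compose[OF proj.linear_axioms
          chain_map_linear] norm_linear]
    by (simp add: o_def)
  fix s assume s: "s \<in> simplices X n"
  let ?t = "inv_into (simplices X n) p (p s)"
  have t: "?t \<in> simplices X n" "p ?t = p s"
    using s by (auto simp: inv_into_into f_inv_into_f)
  then obtain h where "h \<in> carrier G" "\<phi> h s = ?t"
    using p_fibres[OF s t(1)] by auto
  then show "norm_map (sect n (proj (Poly_Mapping.single s 1))) = norm_map (Poly_Mapping.single s 1)"
    using norm_single_act[OF _ s, of h] by (simp add: chain_map_single)
qed

lemma norm_eq_0: "\<lbrakk>c \<in> C n; proj c = 0\<rbrakk> \<Longrightarrow> norm_map c = 0"
  using norm_sect_proj[of c n] by (simp add: chain_map_def norm_map.zero)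

lemma order_nonzero: "(of_nat (Coset.order G) :: complex) \<noteq> 0"
  using finite_G one_closed by (auto simp: Coset.order_def)

lemma boundaries_X: "b \<in> boundaries X n \<longleftrightarrow> (\<exists>e\<in>C (Suc n). b = boundary X (Suc n) e)"
  by (auto simp: boundaries_def carrier_chain_module)

lemma boundaries_Y: "b \<in> boundaries Y n \<longleftrightarrow> (\<exists>e\<in>D (Suc n). b = boundary Y (Suc n) e)"
  by (auto simp: boundaries_def carrier_chain_module)

lemma act_boundaries: "\<lbrakk>g \<in> carrier G; b \<in> boundaries X n\<rbrakk> \<Longrightarrow> act g b \<in> boundaries X n"
  by (auto simp: boundaries_X act_bd intro: act_C)

lemma proj_boundaries: "b \<in> boundaries X n \<Longrightarrow> proj b \<in> boundaries Y n"
  by (auto simp: boundaries_X boundaries_Y proj_bd intro: proj_C)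

text \<open>A boundary of \<open>Y\<close> lifts to a boundary of \<open>X\<close>; the error of the lift is killed by the
  projection, hence by the norm.\<close>

lemma norm_boundaries:
  assumes c: "c \<in> C n" and bd: "proj c \<in> boundaries Y n"
  shows "norm_map c \<in> boundaries X n"
proof -
  obtain d where d: "d \<in> D (Suc n)" "proj c = boundary Y (Suc n) d"
    using bd unfolding boundaries_Y by blast
  define e where "e = sect (Suc n) d"
  then have e: "e \<in> C (Suc n)" "proj e = d"
    using d sect_D proj_sect by auto
  then have "proj (c - boundary X (Suc n) e) = 0"
    using d by (simp add: proj.diff proj_bd)
  then have "norm_map (c - boundary X (Suc n) e) = 0"
    using c e by (intro norm_eq_0[of _ n] chains.subspace_diff subspace_supported bd_C)
  then have "norm_map c = boundary X (Suc n) (norm_map e)"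
    using e by (simp add: norm_map.diff norm_bd)
  then show ?thesis
    using e norm_C unfolding boundaries_X by blast
qed

lemma proj_cycles:
  assumes "c \<in> cycles X n"
  shows "proj c \<in> cycles Y n"
proof -
  have c: "c \<in> C n" "boundary X n c = 0"
    using assms by (simp_all add: cycles_def carrier_chain_module)
  have "boundary Y n (proj c) = 0"
  proof (cases n)
    case (Suc m)
    then show ?thesis
      using c proj_bd[of c m] by (simp add: proj.zero)
  qed (simp add: boundary_def)
  then show ?thesis
    using proj_C[OF c(1)] by (simp add: cycles_def carrier_chain_module)
qed

text \<open>Every cycle of \<open>Y\<close> is, up to the factor \<open>order G\<close>, the projection of a norm, and the norm of
  a lift is a cycle although the lift need not be one.\<close>

lemma ex_invariant_cycle:
  assumes z: "z \<in> cycles Y n"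
  obtains c where "c \<in> cycles X n" "\<And>g. g \<in> carrier G \<Longrightarrow> act g c = c" "proj c = z"
proof -
  define e where "e = sect n z"
  have e: "e \<in> C n" "proj e = z"
    using z sect_D proj_sect by (auto simp: e_def cycles_def carrier_chain_module)
  have "boundary X n (norm_map e) = 0"
  proof (cases n)
    case (Suc m)
    then have "proj (boundary X n e) = 0"
      using e z by (simp add: proj_bd cycles_def)
    then have "norm_map (boundary X n e) = 0"
      using norm_eq_0[of "boundary X n e" m] bd_C[of e m] e Suc by simp
    then show ?thesis
      using norm_bd[of e m] e Suc by simp
  qed (simp add: boundary_def)
  then have cyc: "norm_map e \<in> cycles X n"
    using norm_C e by (simp add: cycles_def carrier_chain_module)
  let ?c = "scl (1 / of_nat (Coset.order G)) (norm_map e)"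
  show thesis
  proof
    show "?c \<in> cycles X n"
      using cyc by (rule chains.subspace_scale[OF subspace_cycles])
    show "act g ?c = ?c" if "g \<in> carrier G" for g
      using act_norm[OF that e(1)] by (simp add: act.scale)
    show "proj ?c = z"
      using order_nonzero by (simp add: proj.scale proj_norm[OF e(1)] e(2))
  qed
qed

text \<open>The cycles whose homology class is invariant; the cycle itself need not be.\<close>

definition invariant_cycles :: "nat \<Rightarrow> 's chain set" where
  "invariant_cycles n = {c \<in> cycles X n. \<forall>g\<in>carrier G. act g c - c \<in> boundaries X n}"

lemma subspace_invariant_cycles: "chains.subspace (invariant_cycles n)"
proof (rule chains.subspaceI)
  note Z = subspace_cycles[of X n] and B = subspace_boundaries[of X n]
  show "0 \<in> invariant_cycles n"
    using chains.subspace_0[OF Z] chains.subspace_0[OF B]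
    by (simp add: invariant_cycles_def act.zero)
  show "x + y \<in> invariant_cycles n" if "x \<in> invariant_cycles n" "y \<in> invariant_cycles n" for x y
    using that chains.subspace_add[OF Z, of x y]
      chains.subspace_add[OF B, of "act g x - x" "act g y - y" for g]
    by (auto simp: invariant_cycles_def act.add algebra_simps)
  show "scl z x \<in> invariant_cycles n" if "x \<in> invariant_cycles n" for z x
    using that chains.subspace_scale[OF Z, of x z]
      chains.subspace_scale[OF B, of "act g x - x" z for g]
    by (auto simp: invariant_cycles_def act.scale chains.scale_right_diff_distrib)
qed

text \<open>The projection is injective on invariant classes: the norm of \<open>c\<close> is a boundary, and it is
  homologous to \<open>order G\<close> times \<open>c\<close>.\<close>

lemma invariant_cycle_boundary:
  assumes c: "c \<in> invariant_cycles n" and bd: "proj c \<in> boundaries Y n"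
  shows "c \<in> boundaries X n"
proof -
  note B = subspace_boundaries[of X n]
  have C: "c \<in> C n"
    using c by (auto simp: invariant_cycles_def cycles_def carrier_chain_module)
  have "(\<Sum>g\<in>carrier G. act g c - c) \<in> boundaries X n"
    using c by (intro chains.subspace_sum[OF B]) (auto simp: invariant_cycles_def)
  also have "(\<Sum>g\<in>carrier G. act g c - c) = norm_map c - scl (of_nat (Coset.order G)) c"
    by (intro poly_mapping_eqI)
      (simp add: norm_map_def sum_subtractf lookup_sum lookup_minus Coset.order_def)
  finally have "norm_map c - (norm_map c - scl (of_nat (Coset.order G)) c) \<in> boundaries X n"
    using norm_boundaries[OF C bd] by (rule chains.subspace_diff[OF B, rotated])
  then have "scl (1 / of_nat (Coset.order G)) (scl (of_nat (Coset.order G)) c) \<in> boundaries X n"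
    by (intro chains.subspace_scale[OF B, of "scl _ c"]) simp
  then show ?thesis
    using order_nonzero by simp
qed

lemma proj_invariant_cycles: "proj ` invariant_cycles n = cycles Y n"
proof (intro subset_antisym subsetI)
  fix z assume "z \<in> cycles Y n"
  then obtain c where "c \<in> cycles X n" "\<And>g. g \<in> carrier G \<Longrightarrow> act g c = c" "proj c = z"
    using ex_invariant_cycle by metis
  then show "z \<in> proj ` invariant_cycles n"
    using chains.subspace_0[OF subspace_boundaries[of X n]]
    by (auto simp: invariant_cycles_def)
qed (auto simp: invariant_cycles_def proj_cycles)

lemma invariant_classes:
  "{v \<in> carrier (homology X n). \<forall>g\<in>carrier G. homology_map X n (\<phi> g) v = v}
    = coset (boundaries X n) ` invariant_cycles n"
proof -
  let ?B = "boundaries X n"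
  have "(\<forall>g\<in>carrier G. homology_map X n (\<phi> g) (coset ?B c) = coset ?B c)
      \<longleftrightarrow> (\<forall>g\<in>carrier G. act g c - c \<in> ?B)" for c
    by (simp add: homology_map_coset[OF act_boundaries] coset_eq_iff[OF subspace_boundaries])
  then show ?thesis
    unfolding carrier_homology invariant_cycles_def by blast
qed

text \<open>A linear map whose kernel is the space of boundaries of \<open>Y\<close>, and its composite with the
  projection, embed the two spaces onto one and the same subspace.\<close>

theorem homology_quotient_dim:
  "vs_dim (homology Y n)
    =o trivial_multiplicity G (homology X n) (\<lambda>g. homology_map X n (\<phi> g))"
proof -
  obtain f :: "'t chain \<Rightarrow> 't chain" where f: "chain_linear f" "\<And>x. f x = 0 \<longleftrightarrow> x \<in> boundaries Y n"
    by (rule ex_linear_with_kernel[OF subspace_boundaries[of Y n]]) blast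
  have fp: "chain_linear (\<lambda>c. f (proj c))"
    using Vector_Spaces.linear_compose[OF proj.linear_axioms f(1)] by (simp add: o_def)
  let ?V = "(homology X n)\<lparr>carrier := {v \<in> carrier (homology X n).
      \<forall>g\<in>carrier G. homology_map X n (\<phi> g) v = v}\<rparr>"
  have Y: "linear_embedding (homology Y n) (\<lambda>C. the_elem (f ` C))"
    "(\<lambda>C. the_elem (f ` C)) ` carrier (homology Y n) = f ` cycles Y n"
    by (rule linear_embedding_quotient[OF subspace_boundaries[of Y n] subspace_cycles[of Y n] f(1)];
        simp add: f carrier_homology zero_homology add_homology smult_homology)+
  have X: "linear_embedding ?V (\<lambda>C. the_elem ((\<lambda>c. f (proj c)) ` C))"
    "(\<lambda>C. the_elem ((\<lambda>c. f (proj c)) ` C)) ` carrier ?V = (\<lambda>c. f (proj c)) ` invariant_cycles n"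
    by (rule linear_embedding_quotient[OF subspace_boundaries[of X n]
          subspace_invariant_cycles[of n] fp];
        simp add: f proj_boundaries invariant_cycle_boundary invariant_classes zero_homology
          add_homology smult_homology)+
  have "(\<lambda>c. f (proj c)) ` invariant_cycles n = f ` cycles Y n"
    using proj_invariant_cycles[of n] by (metis image_image)
  then show ?thesis
    unfolding trivial_multiplicity_def by (intro vs_dim_eqI[OF Y(1) X(1)]) (simp only: X(2) Y(2))
qed

end

section \<open>Paths and functors\<close>

text \<open>The final object of a path, given its initial object.\<close>

fun path_end :: "('o, 'm) cat \<Rightarrow> 'o \<Rightarrow> 'm list \<Rightarrow> 'o" where
  "path_end K a [] = a"
| "path_end K a (f # fs) = path_end K (tgt K f) fs"

lemma path_end_append [simp]: "path_end K a (xs @ ys) = path_end K (path_end K a xs) ys"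
  by (induction xs arbitrary: a) auto

lemma path_end_nth: "fs \<noteq> [] \<Longrightarrow> path_end K a fs = tgt K (fs ! (length fs - 1))"
  by (induction fs rule: rev_induct) auto

lemma is_path_Obj: "is_path K a fs \<Longrightarrow> a \<in> Obj K"
  by (cases fs) auto

lemma is_path_Mor: "is_path K a fs \<Longrightarrow> set fs \<subseteq> Mor K"
  by (induction fs arbitrary: a) auto

lemma is_path_append:
  "is_path K a (xs @ ys) \<longleftrightarrow> is_path K a xs \<and> is_path K (path_end K a xs) ys"
  by (induction xs arbitrary: a) (auto dest: is_path_Obj)

lemma is_path_nth: "\<lbrakk>is_path K a fs; Suc i < length fs\<rbrakk> \<Longrightarrow> src K (fs ! Suc i) = tgt K (fs ! i)"
proof (induction fs arbitrary: a i)
  case (Cons f fs)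
  then show ?case
    by (cases fs; cases i) auto
qed simp

lemma cat_functorD:
  assumes "cat_functor K L F\<^sub>o F\<^sub>m"
  shows "a \<in> Obj K \<Longrightarrow> F\<^sub>o a \<in> Obj L" "f \<in> Mor K \<Longrightarrow> F\<^sub>m f \<in> Mor L"
    "f \<in> Mor K \<Longrightarrow> src L (F\<^sub>m f) = F\<^sub>o (src K f)" "f \<in> Mor K \<Longrightarrow> tgt L (F\<^sub>m f) = F\<^sub>o (tgt K f)"
    "a \<in> Obj K \<Longrightarrow> F\<^sub>m (ident K a) = ident L (F\<^sub>o a)"
    "\<lbrakk>f \<in> Mor K; g \<in> Mor K; src K g = tgt K f\<rbrakk> \<Longrightarrow> F\<^sub>m (cmp K g f) = cmp L (F\<^sub>m g) (F\<^sub>m f)"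
  using assms by (auto simp: cat_functor_def)

lemma cat_functor_id: "cat_functor K K (\<lambda>a. a) (\<lambda>f. f)"
  by (simp add: cat_functor_def)

lemma cat_functor_compose:
  assumes F: "cat_functor K L F\<^sub>o F\<^sub>m" and H: "cat_functor L M H\<^sub>o H\<^sub>m"
  shows "cat_functor K M (\<lambda>a. H\<^sub>o (F\<^sub>o a)) (\<lambda>f. H\<^sub>m (F\<^sub>m f))"
  unfolding cat_functor_def by (simp add: cat_functorD[OF F] cat_functorD[OF H])

lemma functor_path:
  assumes F: "cat_functor K L F\<^sub>o F\<^sub>m" and "is_path K a fs"
  shows "is_path L (F\<^sub>o a) (map F\<^sub>m fs)"
  using assms(2) by (induction fs arbitrary: a) (auto simp: cat_functorD[OF F])

section \<open>Faces of the nerve\<close>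

text \<open>An inner face composes two neighbouring morphisms of the path.\<close>

lemma inner_face_cases:
  assumes "is_path K a fs" "length fs = Suc n" "0 < i" "i < Suc n"
  obtains xs f g ys where "fs = xs @ f # g # ys" "i = Suc (length xs)"
    "f \<in> Mor K" "g \<in> Mor K" "src K g = tgt K f"
proof -
  obtain j where j: "i = Suc j" "Suc j < length fs"
    using assms by (cases i) auto
  have "fs = take j fs @ fs ! j # fs ! Suc j # drop (Suc (Suc j)) fs"
    using j(2) by (metis Cons_nth_drop_Suc Suc_lessD append_take_drop_id)
  with assms(1) j that[of "take j fs" "fs ! j" "fs ! Suc j"] show thesis
    using is_path_Mor[OF assms(1)] is_path_nth[OF assms(1) j(2)] by (simp add: subset_iff)
qed

lemma inner_face:
  assumes "i = Suc (length xs)" "fs = xs @ f # g # ys" "length fs = Suc n"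
  shows "nerve_face K (Suc n) i (a, fs) = (a, xs @ cmp K g f # ys)"
  using assms by (simp add: nth_append)

lemma (in category) nerve_face_closed:
  assumes "s \<in> nerve_simplices K (Suc n)" "i \<le> Suc n"
  shows "nerve_face K (Suc n) i s \<in> nerve_simplices K n"
proof -
  obtain a fs where s: "s = (a, fs)" "is_path K a fs" "length fs = Suc n"
    using assms(1) by (auto simp: nerve_simplices_def)
  consider "i = 0" | "i = Suc n" | "0 < i" "i < Suc n"
    using assms(2) by linarith
  then show ?thesis
  proof cases
    case 1
    then show ?thesis
      using s by (cases fs) (auto simp: nerve_simplices_def)
  next
    case 2
    then show ?thesis
      using s by (cases fs rule: rev_cases) (auto simp: nerve_simplices_def is_path_append)
  next
    case 3
    then obtain xs f g ys where *: "fs = xs @ f # g # ys" "i = Suc (length xs)"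
      "f \<in> Mor K" "g \<in> Mor K" "src K g = tgt K f"
      using inner_face_cases s(2,3) by metis
    then have "is_path K a (xs @ cmp K g f # ys)"
      using s(2) by (auto simp: is_path_append cmp_closed src_cmp tgt_cmp)
    then show ?thesis
      using s(3) * unfolding s(1) inner_face[OF *(2,1) s(3)] by (simp add: nerve_simplices_def)
  qed
qed

lemma nerve_map_closed:
  assumes "cat_functor K L F\<^sub>o F\<^sub>m" "s \<in> nerve_simplices K n"
  shows "nerve_map F\<^sub>o F\<^sub>m s \<in> nerve_simplices L n"
  using assms by (auto simp: nerve_simplices_def nerve_map_def functor_path)

lemma nerve_map_face:
  assumes F: "cat_functor K L F\<^sub>o F\<^sub>m" and s: "s \<in> nerve_simplices K (Suc n)" and i: "i \<le> Suc n"
  shows "nerve_map F\<^sub>o F\<^sub>m (nerve_face K (Suc n) i s) = nerve_face L (Suc n) i (nerve_map F\<^sub>o F\<^sub>m s)"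
proof -
  obtain a fs where s: "s = (a, fs)" "is_path K a fs" "length fs = Suc n"
    using s by (auto simp: nerve_simplices_def)
  consider "i = 0" | "i = Suc n" | "0 < i" "i < Suc n"
    using i by linarith
  then show ?thesis
  proof cases
    case 1
    then show ?thesis
      using s by (cases fs) (auto simp: nerve_map_def cat_functorD[OF F])
  next
    case 2
    then show ?thesis
      using s by (simp add: nerve_map_def map_butlast)
  next
    case 3
    then obtain xs f g ys where *: "fs = xs @ f # g # ys" "i = Suc (length xs)"
      "f \<in> Mor K" "g \<in> Mor K" "src K g = tgt K f"
      using inner_face_cases s(2,3) by metis
    have "nerve_face L (Suc n) i (F\<^sub>o a, map F\<^sub>m fs)
        = (F\<^sub>o a, map F\<^sub>m xs @ cmp L (F\<^sub>m g) (F\<^sub>m f) # map F\<^sub>m ys)"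
      using * s(3) by (intro inner_face) auto
    then show ?thesis
      unfolding s(1) inner_face[OF *(2,1) s(3)] nerve_map_def
      by (simp add: cat_functorD[OF F] *)
  qed
qed

section \<open>Orbit representatives\<close>

text \<open>An action on a set \<open>S\<close> by functions whose values outside \<open>S\<close> are irrelevant.\<close>

locale set_action = group G for G :: "('g, 'x) monoid_scheme" +
  fixes S :: "'a set" and act :: "'g \<Rightarrow> 'a \<Rightarrow> 'a"
  assumes act_closed: "\<lbrakk>g \<in> carrier G; x \<in> S\<rbrakk> \<Longrightarrow> act g x \<in> S"
    and act_one: "x \<in> S \<Longrightarrow> act \<one>\<^bsub>G\<^esub> x = x"
    and act_mult: "\<lbrakk>g \<in> carrier G; h \<in> carrier G; x \<in> S\<rbrakk> \<Longrightarrow> act (g \<otimes>\<^bsub>G\<^esub> h) x = act g (act h x)"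
begin

text \<open>The representative depends only on the orbit as a set, so it is constant on orbits.\<close>

definition rep :: "'a \<Rightarrow> 'a" where
  "rep x = (SOME y. y \<in> orbit G act x)"

lemma orbit_act:
  assumes g: "g \<in> carrier G" and x: "x \<in> S"
  shows "orbit G act (act g x) = orbit G act x"
proof (intro subset_antisym subsetI)
  fix y assume "y \<in> orbit G act (act g x)"
  then obtain h where "h \<in> carrier G" "y = act (h \<otimes>\<^bsub>G\<^esub> g) x"
    using g x by (auto simp: orbit_def act_mult)
  then show "y \<in> orbit G act x"
    using g by (auto simp: orbit_def)
next
  fix y assume "y \<in> orbit G act x"
  then obtain h where h: "h \<in> carrier G" "y = act h x"
    by (auto simp: orbit_def)
  then have "y = act (h \<otimes>\<^bsub>G\<^esub> inv\<^bsub>G\<^esub> g) (act g x)"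
    using g x by (simp add: act_mult[symmetric] m_assoc)
  then show "y \<in> orbit G act (act g x)"
    using g h by (auto simp: orbit_def)
qed

lemma rep_act: "\<lbrakk>g \<in> carrier G; x \<in> S\<rbrakk> \<Longrightarrow> rep (act g x) = rep x"
  by (simp add: rep_def orbit_act)

lemma ex_act_rep:
  assumes "x \<in> S"
  shows "\<exists>g\<in>carrier G. rep x = act g x"
proof -
  have "x \<in> orbit G act x"
    using act_one[OF assms] one_closed by (force simp: orbit_def)
  then have "rep x \<in> orbit G act x"
    unfolding rep_def by (rule someI)
  then show ?thesis
    by (auto simp: orbit_def)
qed

lemma rep_closed: "x \<in> S \<Longrightarrow> rep x \<in> S"
  using ex_act_rep act_closed by metis

lemma rep_rep: "x \<in> S \<Longrightarrow> rep (rep x) = rep x"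
  using ex_act_rep rep_act by metis

lemma rep_eq_iff:
  assumes "x \<in> S" "y \<in> S"
  shows "rep x = rep y \<longleftrightarrow> (\<exists>g\<in>carrier G. act g x = y)"
proof
  assume "rep x = rep y"
  then obtain g h where g: "g \<in> carrier G" "h \<in> carrier G" "act g x = act h y"
    using ex_act_rep assms by metis
  then have "act (inv\<^bsub>G\<^esub> h \<otimes>\<^bsub>G\<^esub> g) x = act (inv\<^bsub>G\<^esub> h) (act h y)"
    using assms by (simp add: act_mult)
  also have "\<dots> = y"
    using g assms by (simp add: act_mult[symmetric] act_one)
  finally show "\<exists>g\<in>carrier G. act g x = y"
    using g by (intro bexI[of _ "inv\<^bsub>G\<^esub> h \<otimes>\<^bsub>G\<^esub> g"]) auto
qed (use rep_act assms in metis)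

lemma orbit_eq_iff:
  assumes "x \<in> S" "y \<in> S"
  shows "orbit G act x = orbit G act y \<longleftrightarrow> (\<exists>g\<in>carrier G. act g x = y)"
  using assms rep_eq_iff orbit_act by (metis rep_def)

end

section \<open>The category of orbits\<close>

context cat_action
begin

sublocale obj: set_action G "Obj K" A\<^sub>o
  by unfold_locales (auto simp: act_one_obj act_mult_obj cat_functorD[OF act_functor])

sublocale mor: set_action G "Mor K" A\<^sub>m
  by unfold_locales (auto simp: act_one_mor act_mult_mor cat_functorD[OF act_functor])

lemmas act_src = cat_functorD(3)[OF act_functor]
  and act_tgt = cat_functorD(4)[OF act_functor]
  and act_ident = cat_functorD(5)[OF act_functor]
  and act_cmp = cat_functorD(6)[OF act_functor]

text \<open>The orbits are encoded by representatives, so that the category of orbits has the same types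
  of objects and morphisms as \<open>K\<close>. To compose the orbits of \<open>g\<close> and \<open>f\<close>, the representative of the
  former is moved to a morphism composable with that of the latter.\<close>

definition orbit_cat :: "('o, 'm) cat" where
  "orbit_cat = \<lparr>Obj = obj.rep ` Obj K, Mor = mor.rep ` Mor K,
     src = (\<lambda>f. obj.rep (src K f)), tgt = (\<lambda>f. obj.rep (tgt K f)),
     ident = (\<lambda>a. mor.rep (ident K a)),
     cmp = (\<lambda>g f. mor.rep
       (cmp K (SOME g'. g' \<in> Mor K \<and> mor.rep g' = mor.rep g \<and> src K g' = tgt K f) f))\<rparr>"

lemma orbit_cat_simps [simp]:
  "Obj orbit_cat = obj.rep ` Obj K" "Mor orbit_cat = mor.rep ` Mor K"
  by (simp_all add: orbit_cat_def)

lemma rep_src: "f \<in> Mor K \<Longrightarrow> src orbit_cat (mor.rep f) = obj.rep (src K f)"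
  using mor.ex_act_rep[of f] by (auto simp: orbit_cat_def act_src obj.rep_act src_closed)

lemma rep_tgt: "f \<in> Mor K \<Longrightarrow> tgt orbit_cat (mor.rep f) = obj.rep (tgt K f)"
  using mor.ex_act_rep[of f] by (auto simp: orbit_cat_def act_tgt obj.rep_act tgt_closed)

lemma rep_ident: "a \<in> Obj K \<Longrightarrow> ident orbit_cat (obj.rep a) = mor.rep (ident K a)"
  using obj.ex_act_rep[of a]
  by (auto simp: orbit_cat_def act_ident[symmetric] mor.rep_act ident_closed)

text \<open>A morphism of orbits that starts at the orbit of \<open>a\<close> lifts to a morphism that starts at \<open>a\<close>.\<close>

lemma lift_orbit:
  assumes "y \<in> Mor orbit_cat" "a \<in> Obj K" "src orbit_cat y = obj.rep a"
  obtains g where "g \<in> Mor K" "mor.rep g = y" "src K g = a"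
proof -
  obtain g where g: "g \<in> Mor K" "y = mor.rep g"
    using assms(1) by auto
  then obtain h where h: "h \<in> carrier G" "A\<^sub>o h (src K g) = a"
    using assms(2,3) by (auto simp: rep_src obj.rep_eq_iff src_closed)
  then show thesis
    using g that[of "A\<^sub>m h g"] by (simp add: mor.rep_act mor.act_closed act_src)
qed

end

text \<open>An action is called regular if it satisfies condition (C).\<close>

locale regular_action = cat_action +
  assumes condition_C: "condition_C G K A\<^sub>m"
begin

text \<open>Condition (C) in terms of paths. For a one-element path it says that the orbit of a composite
  depends only on the orbits of the factors.\<close>

lemma condition_C_path:
  assumes fs: "is_path K a fs" "fs \<noteq> []" and m: "f \<in> Mor K" "g \<in> Mor K"
    and src: "src K f = path_end K a fs" "src K g = path_end K a fs" and eq: "mor.rep f = mor.rep g"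
  obtains h where "h \<in> carrier G" "A\<^sub>m h f = g" "\<And>x. x \<in> set fs \<Longrightarrow> A\<^sub>m h x = x"
proof -
  \<comment> \<open>Condition (C) numbers the morphisms of the path from 1, lists from 0.\<close>
  let ?t = "Suc (length fs)" and ?m = "\<lambda>i. fs ! (i - 1)"
  have "src K (?m i) = tgt K (?m (i - 1))" if "i \<in> {2..length fs}" for i
    using is_path_nth[OF fs(1), of "i - 2"] that by (auto simp: numeral_2_eq_2 Suc_diff_Suc)
  moreover have "?m i \<in> Mor K" if "i \<in> {1..length fs}" for i
    using is_path_Mor[OF fs(1)] that nth_mem[of "i - 1" fs] by (auto simp: subset_iff)
  moreover have "orbit G A\<^sub>m f = orbit G A\<^sub>m g"
    using eq m by (simp add: mor.rep_eq_iff mor.orbit_eq_iff)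
  moreover have "?t \<ge> 2"
    using fs(2) by (cases fs) auto
  ultimately obtain h where h: "h \<in> carrier G" "A\<^sub>m h f = g" "\<forall>i\<in>{1..?t - 1}. A\<^sub>m h (?m i) = ?m i"
    using condition_C[unfolded condition_C_def, rule_format, of ?t ?m f g] m src
      path_end_nth[OF fs(2), of K a] by auto
  show thesis
  proof (rule that[OF h(1,2)])
    fix x assume "x \<in> set fs"
    then obtain i where "i < length fs" "x = fs ! i"
      by (auto simp: in_set_conv_nth)
    with h(3) show "A\<^sub>m h x = x"
      by (auto dest: bspec[of _ _ "Suc i"])
  qed
qed

lemma rep_cmp:
  assumes f: "f \<in> Mor K" and g: "g \<in> Mor K" and comp: "src K g = tgt K f"
  shows "cmp orbit_cat (mor.rep g) (mor.rep f) = mor.rep (cmp K g f)"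
proof -
  obtain h where h: "h \<in> carrier G" "mor.rep f = A\<^sub>m h f"
    using mor.ex_act_rep[OF f] by blast
  let ?f = "A\<^sub>m h f" and ?g = "A\<^sub>m h g"
  define g' where "g' = (SOME g'. g' \<in> Mor K \<and> mor.rep g' = mor.rep (mor.rep g) \<and> src K g' = tgt K ?f)"
  have fg: "?f \<in> Mor K" "?g \<in> Mor K" "src K ?g = tgt K ?f"
    using f g comp h by (simp_all add: mor.act_closed act_src act_tgt)
  then have "?g \<in> Mor K \<and> mor.rep ?g = mor.rep (mor.rep g) \<and> src K ?g = tgt K ?f"
    using g h by (simp add: mor.rep_act mor.rep_rep)
  then have g': "g' \<in> Mor K" "mor.rep g' = mor.rep (mor.rep g)" "src K g' = tgt K ?f"
    unfolding g'_def by (metis (mono_tags, lifting) someI)+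
  moreover have "is_path K (src K ?f) [?f]"
    using fg by (simp add: src_closed tgt_closed)
  moreover have "mor.rep g' = mor.rep ?g"
    using g h g' by (simp add: mor.rep_act mor.rep_rep)
  ultimately obtain k where k: "k \<in> carrier G" "A\<^sub>m k g' = ?g" "A\<^sub>m k ?f = ?f"
    using condition_C_path[of "src K ?f" "[?f]" g' ?g] fg by auto
  have "cmp orbit_cat (mor.rep g) (mor.rep f) = mor.rep (cmp K g' ?f)"
    by (simp add: orbit_cat_def g'_def h(2))
  also have "\<dots> = mor.rep (A\<^sub>m k (cmp K g' ?f))"
    using k fg g' by (simp add: mor.rep_act cmp_closed)
  also have "A\<^sub>m k (cmp K g' ?f) = cmp K ?g ?f"
    using k fg g' by (simp add: act_cmp)
  also have "\<dots> = A\<^sub>m h (cmp K g f)"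
    using h f g comp by (simp add: act_cmp)
  finally show ?thesis
    using h f g comp by (simp add: mor.rep_act cmp_closed)
qed

text \<open>Composable morphisms of orbits lift to composable morphisms of \<open>K\<close>, hence the laws of a
  category are inherited from \<open>K\<close>.\<close>

lemma category_orbit_cat: "category orbit_cat"
proof -
  have lift2: "\<exists>f'\<in>Mor K. \<exists>g'\<in>Mor K. f = mor.rep f' \<and> g = mor.rep g' \<and> src K g' = tgt K f'"
    if f: "f \<in> Mor orbit_cat" and g: "g \<in> Mor orbit_cat"
      and comp: "src orbit_cat g = tgt orbit_cat f" for f g
  proof -
    obtain f' where f': "f' \<in> Mor K" "f = mor.rep f'"
      using f by auto
    then obtain g' where "g' \<in> Mor K" "mor.rep g' = g" "src K g' = tgt K f'"
      using lift_orbit[OF g, of "tgt K f'"] comp by (auto simp: tgt_closed rep_tgt)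
    with f' show ?thesis
      by blast
  qed
  note simps = rep_src rep_tgt rep_ident rep_cmp src_closed tgt_closed ident_closed cmp_closed
    src_cmp tgt_cmp src_ident tgt_ident
  show ?thesis
  proof
    fix f g h
    assume f: "f \<in> Mor orbit_cat" and g: "g \<in> Mor orbit_cat" and h: "h \<in> Mor orbit_cat"
      and comp: "src orbit_cat g = tgt orbit_cat f" "src orbit_cat h = tgt orbit_cat g"
    obtain f' g' where fg: "f' \<in> Mor K" "g' \<in> Mor K" "f = mor.rep f'" "g = mor.rep g'"
      "src K g' = tgt K f'"
      using lift2[OF f g comp(1)] by blast
    obtain h' where "h' \<in> Mor K" "mor.rep h' = h" "src K h' = tgt K g'"
      using lift_orbit[OF h, of "tgt K g'"] comp fg by (auto simp: tgt_closed rep_tgt)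
    with fg show "cmp orbit_cat h (cmp orbit_cat g f) = cmp orbit_cat (cmp orbit_cat h g) f"
      by (auto simp: simps cmp_assoc)
  next
    fix f g
    assume "f \<in> Mor orbit_cat" "g \<in> Mor orbit_cat" "src orbit_cat g = tgt orbit_cat f"
    then obtain f' g' where fg: "f' \<in> Mor K" "g' \<in> Mor K" "f = mor.rep f'" "g = mor.rep g'"
      "src K g' = tgt K f'"
      using lift2 by blast
    then show "cmp orbit_cat g f \<in> Mor orbit_cat"
      "src orbit_cat (cmp orbit_cat g f) = src orbit_cat f"
      "tgt orbit_cat (cmp orbit_cat g f) = tgt orbit_cat g"
      by (simp_all add: simps)
  qed (auto simp: simps cmp_ident_right cmp_ident_left)
qed

lemma action_cocone_orbit_cat: "action_cocone G K A\<^sub>o A\<^sub>m orbit_cat obj.rep mor.rep"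
  by (auto simp: action_cocone_def cat_functor_def category_orbit_cat rep_src rep_tgt rep_ident
      rep_cmp obj.rep_act mor.rep_act)

text \<open>Objects and morphisms of \<open>orbit_cat\<close> are objects and morphisms of \<open>K\<close>, so the functor that a
  cocone induces on the orbits is given by the same two maps.\<close>

lemma cocone_orbit_functor:
  assumes "action_cocone G K A\<^sub>o A\<^sub>m L F\<^sub>o F\<^sub>m"
  shows "cat_functor orbit_cat L F\<^sub>o F\<^sub>m"
proof -
  have F: "cat_functor K L F\<^sub>o F\<^sub>m"
    using assms by (simp add: action_cocone_def)
  have F_rep: "F\<^sub>o (obj.rep a) = F\<^sub>o a" if "a \<in> Obj K" for a
    using obj.ex_act_rep[OF that] that assms by (auto simp: action_cocone_def)
  have F_rep': "F\<^sub>m (mor.rep f) = F\<^sub>m f" if "f \<in> Mor K" for f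
    using mor.ex_act_rep[OF that] that assms by (auto simp: action_cocone_def)
  have "F\<^sub>m (cmp orbit_cat y x) = cmp L (F\<^sub>m y) (F\<^sub>m x)"
    if xy: "x \<in> Mor orbit_cat" "y \<in> Mor orbit_cat" "src orbit_cat y = tgt orbit_cat x" for x y
  proof -
    obtain f where f: "f \<in> Mor K" "x = mor.rep f"
      using xy by auto
    then obtain g where "g \<in> Mor K" "mor.rep g = y" "src K g = tgt K f"
      using lift_orbit[OF xy(2), of "tgt K f"] xy(3) by (auto simp: tgt_closed rep_tgt)
    with f show ?thesis
      by (auto simp: rep_cmp F_rep' cmp_closed cat_functorD[OF F])
  qed
  then show ?thesis
    unfolding cat_functor_def
    by (auto simp: F_rep F_rep' rep_src rep_tgt rep_ident ident_closed src_closed tgt_closed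
        cat_functorD[OF F])
qed

end

section \<open>The quotient category and its nerve\<close>

text \<open>The colimit of a regular action.\<close>

locale regular_quotient = regular_action G K A\<^sub>o A\<^sub>m
  for G :: "('g, 'x) monoid_scheme" and K :: "('o, 'm) cat" and A\<^sub>o A\<^sub>m +
  fixes Q :: "('o, 'm) cat" and P\<^sub>o :: "'o \<Rightarrow> 'o" and P\<^sub>m :: "'m \<Rightarrow> 'm"
  assumes quotient: "is_quotient G K A\<^sub>o A\<^sub>m Q P\<^sub>o P\<^sub>m"
begin

lemma cocone_P: "action_cocone G K A\<^sub>o A\<^sub>m Q P\<^sub>o P\<^sub>m"
  using quotient by (simp add: is_quotient_def)

lemma functor_P: "cat_functor K Q P\<^sub>o P\<^sub>m"
  using cocone_P by (simp add: action_cocone_def)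

lemma P_act:
  "\<lbrakk>g \<in> carrier G; a \<in> Obj K\<rbrakk> \<Longrightarrow> P\<^sub>o (A\<^sub>o g a) = P\<^sub>o a"
  "\<lbrakk>g \<in> carrier G; f \<in> Mor K\<rbrakk> \<Longrightarrow> P\<^sub>m (A\<^sub>m g f) = P\<^sub>m f"
  using cocone_P by (auto simp: action_cocone_def)

text \<open>The comparison functor to the category of orbits separates orbits. Followed by the functor
  induced by the projection it is an endofunctor of \<open>Q\<close> compatible with the projection, hence the
  identity; so the projection is onto.\<close>

lemma ex_comparison:
  obtains U\<^sub>o U\<^sub>m where "cat_functor Q orbit_cat U\<^sub>o U\<^sub>m"
    "\<And>a. a \<in> Obj K \<Longrightarrow> U\<^sub>o (P\<^sub>o a) = obj.rep a" "\<And>f. f \<in> Mor K \<Longrightarrow> U\<^sub>m (P\<^sub>m f) = mor.rep f"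
    "\<And>b. b \<in> Obj Q \<Longrightarrow> P\<^sub>o (U\<^sub>o b) = b" "\<And>h. h \<in> Mor Q \<Longrightarrow> P\<^sub>m (U\<^sub>m h) = h"
proof -
  note universal = quotient[unfolded is_quotient_def, THEN conjunct2, rule_format]
  obtain U\<^sub>o U\<^sub>m where U: "cat_functor Q orbit_cat U\<^sub>o U\<^sub>m"
    "\<forall>a\<in>Obj K. U\<^sub>o (P\<^sub>o a) = obj.rep a" "\<forall>f\<in>Mor K. U\<^sub>m (P\<^sub>m f) = mor.rep f"
    using universal[OF action_cocone_orbit_cat] by blast
  obtain W\<^sub>o W\<^sub>m where W: "\<And>V\<^sub>o V\<^sub>m. cat_functor Q Q V\<^sub>o V\<^sub>m \<Longrightarrow> \<forall>a\<in>Obj K. V\<^sub>o (P\<^sub>o a) = P\<^sub>o a \<Longrightarrow>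
      \<forall>f\<in>Mor K. V\<^sub>m (P\<^sub>m f) = P\<^sub>m f \<Longrightarrow> (\<forall>b\<in>Obj Q. V\<^sub>o b = W\<^sub>o b) \<and> (\<forall>h\<in>Mor Q. V\<^sub>m h = W\<^sub>m h)"
    using universal[OF cocone_P] by blast
  have "P\<^sub>o (obj.rep a) = P\<^sub>o a" if "a \<in> Obj K" for a
    using obj.ex_act_rep[OF that] that by (auto simp: P_act)
  moreover have "P\<^sub>m (mor.rep f) = P\<^sub>m f" if "f \<in> Mor K" for f
    using mor.ex_act_rep[OF that] that by (auto simp: P_act)
  ultimately have "(\<forall>b\<in>Obj Q. P\<^sub>o (U\<^sub>o b) = W\<^sub>o b) \<and> (\<forall>h\<in>Mor Q. P\<^sub>m (U\<^sub>m h) = W\<^sub>m h)"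
    using U(2,3) by (intro W cat_functor_compose[OF U(1) cocone_orbit_functor[OF cocone_P]]) auto
  moreover have "(\<forall>b\<in>Obj Q. b = W\<^sub>o b) \<and> (\<forall>h\<in>Mor Q. h = W\<^sub>m h)"
    by (rule W[OF cat_functor_id]) auto
  ultimately show thesis
    using U by (intro that[of U\<^sub>o U\<^sub>m]) auto
qed

lemma P_Obj_onto: "P\<^sub>o ` Obj K = Obj Q"
proof (rule ex_comparison)
  fix U\<^sub>o U\<^sub>m
  assume U: "cat_functor Q orbit_cat U\<^sub>o U\<^sub>m" and PU: "\<And>b. b \<in> Obj Q \<Longrightarrow> P\<^sub>o (U\<^sub>o b) = b"
  have "b \<in> P\<^sub>o ` Obj K" if "b \<in> Obj Q" for b
    using cat_functorD(1)[OF U that] PU[OF that] obj.rep_closed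
    by (auto intro!: image_eqI[of b P\<^sub>o "U\<^sub>o b"])
  then show ?thesis
    using cat_functorD(1)[OF functor_P] by auto
qed

lemma P_Mor_onto: "P\<^sub>m ` Mor K = Mor Q"
proof (rule ex_comparison)
  fix U\<^sub>o U\<^sub>m
  assume U: "cat_functor Q orbit_cat U\<^sub>o U\<^sub>m" and PU: "\<And>h. h \<in> Mor Q \<Longrightarrow> P\<^sub>m (U\<^sub>m h) = h"
  have "h \<in> P\<^sub>m ` Mor K" if "h \<in> Mor Q" for h
    using cat_functorD(2)[OF U that] PU[OF that] mor.rep_closed
    by (auto intro!: image_eqI[of h P\<^sub>m "U\<^sub>m h"])
  then show ?thesis
    using cat_functorD(2)[OF functor_P] by auto
qed

text \<open>The projection identifies only what lies in one orbit.\<close>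

lemma P_Obj_eqD: "\<lbrakk>P\<^sub>o a = P\<^sub>o b; a \<in> Obj K; b \<in> Obj K\<rbrakk> \<Longrightarrow> \<exists>g\<in>carrier G. A\<^sub>o g a = b"
  by (metis ex_comparison obj.rep_eq_iff)

lemma P_Mor_eqD: "\<lbrakk>P\<^sub>m f = P\<^sub>m g; f \<in> Mor K; g \<in> Mor K\<rbrakk> \<Longrightarrow> mor.rep f = mor.rep g"
  by (metis ex_comparison)

lemma lift_path:
  assumes "is_path Q (P\<^sub>o a) hs" "a \<in> Obj K"
  shows "\<exists>fs. is_path K a fs \<and> map P\<^sub>m fs = hs"
  using assms
proof (induction hs arbitrary: a)
  case (Cons h hs)
  then have "h \<in> P\<^sub>m ` Mor K"
    by (simp add: P_Mor_onto)
  then obtain f where f: "f \<in> Mor K" "h = P\<^sub>m f"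
    by blast
  with Cons.prems have "P\<^sub>o (src K f) = P\<^sub>o a"
    by (simp add: cat_functorD[OF functor_P])
  then obtain g where g: "g \<in> carrier G" "A\<^sub>o g (src K f) = a"
    using P_Obj_eqD[of "src K f" a] f Cons.prems(2) src_closed by auto
  have f': "A\<^sub>m g f \<in> Mor K" "src K (A\<^sub>m g f) = a" "P\<^sub>m (A\<^sub>m g f) = h"
    using f g by (auto simp: mor.act_closed act_src P_act)
  then have "is_path Q (P\<^sub>o (tgt K (A\<^sub>m g f))) hs"
    using Cons.prems cat_functorD(4)[OF functor_P f'(1)] by simp
  then obtain fs where "is_path K (tgt K (A\<^sub>m g f)) fs" "map P\<^sub>m fs = hs"
    using Cons.IH f'(1) tgt_closed by blast
  with f' Cons.prems(2) show ?case
    by (intro exI[of _ "A\<^sub>m g f # fs"]) auto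
qed auto

text \<open>By induction on the length, with condition (C) moving the last morphism into place while the
  earlier ones stay fixed.\<close>

lemma path_orbit:
  assumes "is_path K a fs" "is_path K b gs" "P\<^sub>o a = P\<^sub>o b" "map P\<^sub>m fs = map P\<^sub>m gs"
  shows "\<exists>g\<in>carrier G. A\<^sub>o g a = b \<and> map (A\<^sub>m g) fs = gs"
  using assms
proof (induction fs arbitrary: gs rule: rev_induct)
  case Nil
  then show ?case
    using P_Obj_eqD[of a b] by auto
next
  case (snoc f fs)
  then obtain gs' g where gs: "gs = gs' @ [g]"
    by (cases gs rule: rev_cases) auto
  have path: "is_path K a fs" "is_path K b gs'" and fg: "f \<in> Mor K" "g \<in> Mor K"
    and src: "src K f = path_end K a fs" "src K g = path_end K b gs'"
    and eq: "map P\<^sub>m fs = map P\<^sub>m gs'" "mor.rep f = mor.rep g"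
    using snoc.prems gs by (auto simp: is_path_append intro!: P_Mor_eqD)
  note ab = is_path_Obj[OF path(1)] is_path_Obj[OF path(2)]
  show ?case
  proof (cases "gs' = []")
    case True
    then have "fs = []"
      using eq(1) by simp
    moreover obtain h where h: "h \<in> carrier G" "A\<^sub>m h f = g"
      using eq(2) fg mor.rep_eq_iff by auto
    moreover from h have "A\<^sub>o h a = b"
      using act_src[OF h(1) fg(1)] src True \<open>fs = []\<close> by simp
    ultimately show ?thesis
      using gs True by auto
  next
    case False
    obtain h where h: "h \<in> carrier G" "A\<^sub>o h a = b" "map (A\<^sub>m h) fs = gs'"
      using snoc.IH[OF path snoc.prems(3) eq(1)] by blast
    let ?f = "A\<^sub>m h f"
    have "path_end K (A\<^sub>o h a) (map (A\<^sub>m h) fs) = A\<^sub>o h (path_end K a fs)"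
      using is_path_Mor[OF path(1)] False h
      by (cases fs rule: rev_cases) (auto simp: act_tgt)
    then have f: "?f \<in> Mor K" "src K ?f = path_end K b gs'" "mor.rep ?f = mor.rep g"
      using h fg src eq by (simp_all add: mor.act_closed act_src mor.rep_act)
    obtain k where k: "k \<in> carrier G" "A\<^sub>m k ?f = g" "\<And>x. x \<in> set gs' \<Longrightarrow> A\<^sub>m k x = x"
      by (rule condition_C_path[OF path(2) False f(1) fg(2) f(2) src(2) f(3)]) blast
    have "hd gs' \<in> set gs'" "hd gs' \<in> Mor K" "src K (hd gs') = b"
      using False path(2) by (cases gs'; auto)+
    then have "A\<^sub>o k b = b"
      using act_src[OF k(1), of "hd gs'"] k(3) by auto
    moreover have "map (A\<^sub>m (k \<otimes>\<^bsub>G\<^esub> h)) fs = map (A\<^sub>m k) gs'"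
      using is_path_Mor[OF path(1)] h k by (auto simp: act_mult_mor subset_iff)
    moreover have "map (A\<^sub>m k) gs' = gs'"
      using k(3) by (simp add: map_idI)
    ultimately show ?thesis
      using h k gs ab fg
      by (intro bexI[of _ "k \<otimes>\<^bsub>G\<^esub> h"]) (auto simp: act_mult_obj act_mult_mor)
  qed
qed

lemma simplicial_quotient_nerve:
  assumes "finite (carrier G)"
  shows "simplicial_quotient G (nerve K) (nerve Q) (\<lambda>g. nerve_map (A\<^sub>o g) (A\<^sub>m g)) (nerve_map P\<^sub>o P\<^sub>m)"
proof
  fix n
  have simps: "simplices (nerve L) n = nerve_simplices L n" for L :: "('o, 'm) cat"
    by (simp add: nerve_def)
  show "nerve_map P\<^sub>o P\<^sub>m ` simplices (nerve K) n = simplices (nerve Q) n"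
    unfolding simps
  proof (intro subset_antisym subsetI)
    fix t assume "t \<in> nerve_simplices Q n"
    then obtain b hs where t: "t = (b, hs)" "is_path Q b hs" "length hs = n"
      by (auto simp: nerve_simplices_def)
    then obtain a where a: "a \<in> Obj K" "b = P\<^sub>o a"
      using is_path_Obj[OF t(2)] P_Obj_onto by blast
    then obtain fs where "is_path K a fs" "map P\<^sub>m fs = hs"
      using lift_path t(2) by blast
    with t a show "t \<in> nerve_map P\<^sub>o P\<^sub>m ` nerve_simplices K n"
      by (intro image_eqI[of _ _ "(a, fs)"]) (auto simp: nerve_simplices_def nerve_map_def)
  qed (auto intro: nerve_map_closed[OF functor_P])
  show "nerve_map P\<^sub>o P\<^sub>m s = nerve_map P\<^sub>o P\<^sub>m t
      \<longleftrightarrow> (\<exists>g\<in>carrier G. nerve_map (A\<^sub>o g) (A\<^sub>m g) s = t)"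
    if st: "s \<in> simplices (nerve K) n" "t \<in> simplices (nerve K) n" for s t
  proof -
    obtain a fs b gs where *: "s = (a, fs)" "is_path K a fs" "t = (b, gs)" "is_path K b gs"
      using st unfolding simps by (auto simp: nerve_simplices_def)
    show ?thesis
    proof
      assume "nerve_map P\<^sub>o P\<^sub>m s = nerve_map P\<^sub>o P\<^sub>m t"
      then show "\<exists>g\<in>carrier G. nerve_map (A\<^sub>o g) (A\<^sub>m g) s = t"
        using path_orbit[OF *(2,4)] by (auto simp: * nerve_map_def)
    next
      assume "\<exists>g\<in>carrier G. nerve_map (A\<^sub>o g) (A\<^sub>m g) s = t"
      then show "nerve_map P\<^sub>o P\<^sub>m s = nerve_map P\<^sub>o P\<^sub>m t"
        using is_path_Obj[OF *(2)] is_path_Mor[OF *(2)]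
        by (auto simp: * nerve_map_def P_act subset_iff)
    qed
  qed
  show "nerve_map (A\<^sub>o (g \<otimes>\<^bsub>G\<^esub> h)) (A\<^sub>m (g \<otimes>\<^bsub>G\<^esub> h)) s
      = nerve_map (A\<^sub>o g) (A\<^sub>m g) (nerve_map (A\<^sub>o h) (A\<^sub>m h) s)"
    if "g \<in> carrier G" "h \<in> carrier G" "s \<in> simplices (nerve K) n" for g h s
    using that is_path_Obj[of K "fst s"] is_path_Mor[of K "fst s" "snd s"] unfolding simps
    by (auto simp: nerve_simplices_def nerve_map_def act_mult_obj act_mult_mor subset_iff)
qed (use assms in \<open>auto simp: nerve_def nerve_map_closed[OF act_functor] nerve_face_closed
    nerve_map_face[OF act_functor] nerve_map_face[OF functor_P] simp del: nerve_face.simps\<close>)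

end

section \<open>Betti numbers of the quotient\<close>

theorem proposition4p1:
  fixes G :: "('g, 'x) monoid_scheme"
    and K Q :: "('o, 'm) cat"
    and A\<^sub>o :: "'g \<Rightarrow> 'o \<Rightarrow> 'o" and A\<^sub>m :: "'g \<Rightarrow> 'm \<Rightarrow> 'm"
    and P\<^sub>o :: "'o \<Rightarrow> 'o" and P\<^sub>m :: "'m \<Rightarrow> 'm"
    and i :: nat
  assumes "finite (carrier G)"
    and "cat_action G K A\<^sub>o A\<^sub>m"
    and "without_inverses K"
    and "condition_C G K A\<^sub>m"
    and "is_quotient G K A\<^sub>o A\<^sub>m Q P\<^sub>o P\<^sub>m"
  shows "betti (nerve Q) i =o
    trivial_multiplicity G (homology (nerve K) i) (induced_rep K A\<^sub>o A\<^sub>m i)"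
proof -
  interpret regular_quotient G K A\<^sub>o A\<^sub>m Q P\<^sub>o P\<^sub>m
    using assms by (intro regular_quotient.intro regular_action.intro regular_action_axioms.intro
        regular_quotient_axioms.intro)
  interpret simplicial_quotient G "nerve K" "nerve Q" "\<lambda>g. nerve_map (A\<^sub>o g) (A\<^sub>m g)" "nerve_map P\<^sub>o P\<^sub>m"
    using assms(1) by (rule simplicial_quotient_nerve)
  have "induced_rep K A\<^sub>o A\<^sub>m i = (\<lambda>g. homology_map (nerve K) i (nerve_map (A\<^sub>o g) (A\<^sub>m g)))"
    by (simp add: induced_rep_def fun_eq_iff)
  then show ?thesis
    unfolding betti_def by (simp add: homology_quotient_dim)
qed

end
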